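(* Assume $m,n\ge4$, let $x=(x_1,\dots,x_m)$, $y=(y_1,\dots,y_n)$ be disjoint sets of variables, and for $0\le\ell\le u\le4$ let $$\mathcal{B}^{\ell,u}_{m,n}(x,y)=\sum_{i=\ell}^u\sigma_i(x)\,\sigma_{4-i}(y).$$ Then $\mathcal{B}^{\ell,u}_{m,n}$ is a Gårding polynomial (equivalently, the rank four matroid on $A\sqcup B$ with $|A|=m$, $|B|=n$, whose bases are the four-element subsets $T$ with $\ell\le|T\cap A|\le u$, is $B$-Gårding) exactly in the following cases: - for $(\ell,u)\in\{(0,0),(0,1),(0,4),(1,1),(1,2),(2,2),(2,3),(3,3),(3,4),(4,4)\}$: always; - for $(\ell,u)=(0,2)$: if and only if $mn\le5m+3n-9$; - for $(\ell,u)=(2,4)$: if and only if $mn\le3m+5n-9$; - for $(\ell,u)\in\{(0,3),(1,3),(1,4)\}$: if and only if $mn\le5m+5n-13$.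
   Context: $\sigma_k$ denotes the $k$-th elementary symmetric polynomial ($\sigma_0=1$). Let $\Gamma_N^+=\{z\in\mathbb{R}^N:z_i>0\ \forall i\}$. A set $R\subset\mathbb{R}^N$ passes the positive ray test (PRT) if $R+\overline{\Gamma_N^+}\subset R$. A nonzero multi-affine polynomial $f$ in $N$ variables (degree at most 1 in each variable) is Gårding if some nonempty connected component of $\{f>0\}$ passes PRT. A matroid is $B$-Gårding if its basis generating function $\sum_{B\text{ basis}}\prod_{e\in B}w_e$ is Gårding. *)

theory Defs
  imports "HOL-Analysis.Analysis"
begin

text \<open>
  The variables are indexed by a finite type \<open>'e\<close>, so that \<open>\<real>\<^sup>N\<close> is \<open>real ^ 'e\<close> with
  \<open>N = CARD('e)\<close>.  Polynomials are represented by the functions they induce; over the reals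
  this loses nothing, and a polynomial is zero iff its function is.
\<close>

definition pos_orthant :: "(real ^ 'e::finite) set" where
  "pos_orthant = {z. \<forall>i. 0 < z $ i}"

definition passes_PRT :: "(real ^ 'e::finite) set \<Rightarrow> bool" where
  "passes_PRT R \<longleftrightarrow> {r + z | r z. r \<in> R \<and> z \<in> closure pos_orthant} \<subseteq> R"

definition multi_affine :: "(real ^ 'e::finite \<Rightarrow> real) \<Rightarrow> bool" where
  "multi_affine f \<longleftrightarrow>
     (\<exists>c :: 'e set \<Rightarrow> real. \<forall>w. f w = (\<Sum>S\<in>UNIV. c S * (\<Prod>e\<in>S. w $ e)))"

text \<open>Members of \<^const>\<open>components\<close> are nonempty by definition, and there are none if \<open>{f > 0}\<close>
  is empty.\<close>

definition garding :: "(real ^ 'e::finite \<Rightarrow> real) \<Rightarrow> bool" where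
  "garding f \<longleftrightarrow>
     multi_affine f \<and> f \<noteq> (\<lambda>w. 0) \<and> (\<exists>C \<in> components {w. 0 < f w}. passes_PRT C)"

text \<open>\<open>esym k A w\<close> is \<open>\<sigma>\<^sub>k\<close> evaluated at the variables of \<open>w\<close> whose index lies in \<open>A\<close>.\<close>

definition esym :: "nat \<Rightarrow> 'e set \<Rightarrow> real ^ 'e::finite \<Rightarrow> real" where
  "esym k A w = (\<Sum>S | S \<subseteq> A \<and> card S = k. \<Prod>e\<in>S. w $ e)"

text \<open>The polynomial \<open>\<B>\<close> with parameters \<open>\<ell>\<close>, \<open>u\<close>; the variables \<open>x\<close> are those indexed by \<open>A\<close>
  and the variables \<open>y\<close> are those indexed by \<open>B\<close>.\<close>

definition bip_poly :: "nat \<Rightarrow> nat \<Rightarrow> 'e set \<Rightarrow> 'e set \<Rightarrow> real ^ 'e::finite \<Rightarrow> real" where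
  "bip_poly l u A B w = (\<Sum>i = l..u. esym i A w * esym (4 - i) B w)"

text \<open>A matroid on the ground set \<open>UNIV :: 'e set\<close> is given by its set of bases.\<close>

definition matroid_bases :: "'e::finite set set \<Rightarrow> bool" where
  "matroid_bases \<B> \<longleftrightarrow> \<B> \<noteq> {} \<and>
     (\<forall>S\<in>\<B>. \<forall>T\<in>\<B>. \<forall>a\<in>S - T. \<exists>b\<in>T - S. insert b (S - {a}) \<in> \<B>)"

definition basis_genfun :: "'e::finite set set \<Rightarrow> real ^ 'e \<Rightarrow> real" where
  "basis_genfun \<B> w = (\<Sum>T\<in>\<B>. \<Prod>e\<in>T. w $ e)"

text \<open>To be applied to \<open>\<B>\<close> satisfying \<^const>\<open>matroid_bases\<close>.\<close>

definition B_garding :: "'e::finite set set \<Rightarrow> bool" where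
  "B_garding \<B> \<longleftrightarrow> garding (basis_genfun \<B>)"

end

theory Submission
  imports Defs "HOL-Computational_Algebra.Fundamental_Theorem_Algebra"
begin

text \<open>
  Let \<open>X\<^sub>k\<close> and \<open>Y\<^sub>k\<close> denote the values of \<open>\<sigma>\<^sub>k\<close> at the \<open>x\<close>- and at the \<open>y\<close>-variables.

  \<^bold>\<open>What has to be checked.\<close>  A multi-affine \<open>f\<close> with nonnegative coefficients is positive on the
  open orthant, so the only component of \<open>{f > 0}\<close> that can be stable under adding nonnegative vectors
  is the component \<open>C\<close> that contains the orthant.  Since \<open>f\<close> is affine in each variable, a zero of
  \<open>\<partial>\<^sub>j f\<close> in \<open>C\<close> puts a whole line parallel to the \<open>j\<close>-th axis into \<open>C\<close>.  So if \<open>C\<close> lies in a region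
  that contains no such line for the variables on which \<open>f\<close> depends, then \<open>\<partial>\<^sub>j f\<close> has no zero on the
  connected set \<open>C\<close>; it is positive at a positive point, hence on \<open>C\<close>, and \<open>C\<close> passes the positive ray test.  The region is cut out by
  finitely many barrier functions that cannot reach \<open>0\<close> as long as \<open>f > 0\<close>; this is
  \<open>garding_criterion\<close>.  Thus the positive half of the theorem amounts to inequalities \<open>f \<le> 0\<close> on the
  zero sets of the barriers.

  \<^bold>\<open>Barriers.\<close>  The natural choices are \<open>Y\<^sub>1\<close>, whose positivity excludes lines in the \<open>y\<close>-directions, and
  the derivatives of \<open>f\<close> along the all-ones vector of the \<open>x\<close>-space.  For \<open>(0,2)\<close> they are \<open>Y\<^sub>1\<close>, \<open>Y\<^sub>2\<close>
  and \<open>D = m Y\<^sub>3 + (m-1) X\<^sub>1 Y\<^sub>2\<close>.  For \<open>(0,3)\<close> and \<open>(1,3)\<close> they are \<open>Y\<^sub>1\<close>,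
  \<open>S = m Y\<^sub>2 + (m-2) X\<^sub>1 Y\<^sub>1\<close> and \<open>D = m Y\<^sub>3 + (m-1) X\<^sub>1 Y\<^sub>2 + (m-2) X\<^sub>2 Y\<^sub>1\<close>.

  \<^bold>\<open>Inequalities.\<close>  The points are arbitrary real points, so Newton-type inequalities without sign
  conditions are needed.  They come from real-rootedness: derivatives and polar derivatives of
  \<open>\<Prod>(1 + y\<^sub>i X)\<close> have only real roots.  Hence \<open>\<sigma>\<^sub>1, \<sigma>\<^sub>2, \<sigma>\<^sub>3\<close> of any \<open>n \<ge> 3\<close> reals, divided by the number of
  their monomials, agree with those of three suitable reals (\<open>esym_three\<close>), and if \<open>\<sigma>\<^sub>1 \<noteq> 0\<close>, the
  normalised \<open>\<sigma>\<^sub>1, \<dots>, \<sigma>\<^sub>4\<close> are proportional to the normalised \<open>\<sigma>\<^sub>0, \<dots>, \<sigma>\<^sub>3\<close> of three reals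
  (\<open>esym_four\<close>).  All estimates thereby become statements about triples of reals.

  On \<open>D = 0\<close> the case \<open>(0,2)\<close> gives \<open>f \<le> Y\<^sub>4 - m/(2(m-1)) Y\<^sub>3\<^sup>2/Y\<^sub>2\<close>, and Newton's bound for
  \<open>Y\<^sub>2 Y\<^sub>4 / Y\<^sub>3\<^sup>2\<close> makes this nonpositive exactly under \<open>mn \<le> 5m + 3n - 9\<close>.  In the case \<open>(1,3)\<close>,
  translating the \<open>x\<close>-variables by \<open>a = Y\<^sub>2/((m-2) Y\<^sub>1)\<close> removes the quadratic term, and \<open>D = 0\<close> yields
  \<open>f \<le> - Y\<^sub>1 \<cdot> (m choose 3) \<cdot> (z-a)\<^sup>2 (2z+a)\<close> with \<open>z \<ge> 0\<close> given by
  \<open>z\<^sup>2 = a\<^sup>2 - Y\<^sub>3/((m-1 choose 2) Y\<^sub>1)\<close>; the condition \<open>mn \<le> 5m + 5n - 13\<close> makes the right hand side of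
  the last equation nonnegative, and \<open>2z + a \<ge> 0\<close> follows since Newton's bound
  for \<open>Y\<^sub>1 Y\<^sub>3\<close> improves by the factor \<open>3/4\<close> where \<open>Y\<^sub>2 \<le> 0\<close>.  In the case \<open>(0,3)\<close> the additional term \<open>Y\<^sub>4\<close> is dominated by this
  negative term, because the sharp upper bound for \<open>Y\<^sub>4\<close> has the same shape (\<open>cubic_comparison\<close>).

  \<^bold>\<open>Failure.\<close>  If the numerical condition fails, a quadratic polynomial in \<open>s\<close> has no real root: \<open>f\<close>
  itself at \<open>x = (s,\<dots>,s)\<close>, \<open>y = (1,\<dots>,1)\<close> for \<open>(0,2)\<close>, and a partial derivative \<open>\<partial>f/\<partial>x\<^sub>j\<close> there for
  \<open>(0,3)\<close> and \<open>(1,3)\<close>.  So \<open>s\<close> can be moved to negative values inside \<open>C\<close>, in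
  the latter cases with a large value of \<open>x\<^sub>j\<close>, to a point from which some
  nonnegative vector leads to a place where \<open>f \<le> 0\<close>.

  The remaining cases follow by exchanging \<open>x\<close> and \<open>y\<close>, which turns \<open>(l, u)\<close> into \<open>(4-u, 4-l)\<close>.
\<close>

section \<open>Real-rooted polynomials and elementary symmetric functions of lists\<close>

fun esym_list :: "nat \<Rightarrow> real list \<Rightarrow> real" where
  "esym_list 0 ys = 1"
| "esym_list (Suc k) [] = 0"
| "esym_list (Suc k) (y # ys) = esym_list (Suc k) ys + y * esym_list k ys"

text \<open>
  The factors are \<open>1 + y X\<close> rather than \<open>X - r\<close>, so that an entry \<open>0\<close> only lowers the degree and
  the number of list entries can stay fixed while degrees drop.  The coefficients are complex because
  real-rootedness is tested on the nonreal numbers.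
\<close>
definition root_poly :: "real list \<Rightarrow> complex poly" where
  "root_poly ys = (\<Prod>y\<leftarrow>ys. [:1, of_real y:])"

lemma root_poly_simps [simp]:
  "root_poly [] = 1" "root_poly (y # ys) = [:1, of_real y:] * root_poly ys"
  by (simp_all add: root_poly_def)

lemma coeff_root_poly: "coeff (root_poly ys) k = of_real (esym_list k ys)"
proof (induction ys arbitrary: k)
  case Nil
  then show ?case by (cases k) auto
next
  case (Cons y ys)
  then show ?case by (cases k) (auto simp: coeff_pCons)
qed

lemma degree_root_poly: "degree (root_poly ys) \<le> length ys"
proof (induction ys)
  case (Cons y ys)
  have "degree (root_poly (y # ys)) \<le> degree [:1, complex_of_real y:] + degree (root_poly ys)"
    unfolding root_poly_simps by (rule degree_mult_le)
  also have "\<dots> \<le> 1 + length ys"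
    using Cons by (intro add_mono) auto
  finally show ?case by simp
qed auto

text \<open>
  Split off one root after the other by the fundamental theorem of algebra; factors missing from the
  degree bound are filled up with zeros.
\<close>
lemma real_rooted_factorization:
  assumes "poly q 0 \<noteq> 0" and "degree q \<le> K" and "\<And>z. Im z \<noteq> 0 \<Longrightarrow> poly q z \<noteq> 0"
  shows "\<exists>zs. length zs = K \<and> q = smult (poly q 0) (root_poly zs)"
  using assms
proof (induction K arbitrary: q)
  case 0
  then obtain c where "q = [:c:]" by (metis degree_eq_zeroE le_zero_eq)
  then show ?case by simp
next
  case (Suc K)
  show ?case
  proof (cases "degree q = 0")
    case True
    then have "degree q \<le> K" by simp
    from Suc.IH[OF Suc.prems(1) this Suc.prems(3)] obtain zs
      where "length zs = K" "q = smult (poly q 0) (root_poly zs)"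
      by blast
    then have "length (0 # zs) = Suc K \<and> q = smult (poly q 0) (root_poly (0 # zs))"
      by simp
    then show ?thesis by blast
  next
    case False
    then obtain z where z: "poly q z = 0"
      using fundamental_theorem_of_algebra[of q] constant_degree[of q] by auto
    define a where "a = Re z"
    have za: "z = of_real a"
      using Suc.prems(3)[of z] z by (auto simp: a_def complex_eq_iff)
    have a0: "a \<noteq> 0" using z za Suc.prems(1) by auto
    from z obtain r where r: "q = [:- z, 1:] * r"
      unfolding poly_eq_0_iff_dvd by (auto elim: dvdE)
    have "r \<noteq> 0" using r Suc.prems(1) by auto
    then have "degree q = Suc (degree r)"
      unfolding r by (subst degree_mult_eq) auto
    moreover have "poly r 0 \<noteq> 0" "\<And>z. Im z \<noteq> 0 \<Longrightarrow> poly r z \<noteq> 0"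
      using Suc.prems(1,3) unfolding r by auto
    ultimately obtain zs where zs: "length zs = K" "r = smult (poly r 0) (root_poly zs)"
      using Suc.IH[of r] Suc.prems(2) by auto
    have eq: "[:- z, 1:] = smult (- z) [:1, of_real (- 1 / a):]"
      using a0 by (simp add: za field_simps)
    have q0: "poly q 0 = - z * poly r 0" unfolding r by simp
    have "q = smult (- z) [:1, of_real (- 1 / a):] * smult (poly r 0) (root_poly zs)"
      using r zs(2) eq by metis
    also have "\<dots> = smult (poly q 0) (root_poly ((- 1 / a) # zs))"
      unfolding q0 root_poly_simps by (simp only: mult_smult_left mult_smult_right smult_smult mult.commute)
    finally show ?thesis using zs(1) by (metis length_Cons)
  qed
qed

lemma one_plus_real_mult_nonzero:
  assumes "Im z \<noteq> 0"
  shows "1 + complex_of_real y * z \<noteq> 0"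
proof
  assume *: "1 + complex_of_real y * z = 0"
  from arg_cong[OF *, of Im] assms have "y = 0" by simp
  with * show False by simp
qed

lemma root_poly_nonreal:
  assumes "Im z \<noteq> 0"
  shows "poly (root_poly ys) z \<noteq> 0"
proof (induction ys)
  case (Cons y ys)
  then show ?case
    using one_plus_real_mult_nonzero[OF assms, of y]
    unfolding root_poly_simps poly_mult by (simp add: mult.commute)
qed simp

text \<open>
  The logarithmic derivative; it is what makes the Gauss--Lucas argument below work.
\<close>
lemma poly_pderiv_root_poly:
  assumes "Im z \<noteq> 0"
  shows "poly (pderiv (root_poly ys)) z =
    poly (root_poly ys) z * (\<Sum>y\<leftarrow>ys. of_real y / (1 + of_real y * z))"
proof (induction ys)
  case (Cons y ys)
  have "1 + of_real y * z \<noteq> 0" by (rule one_plus_real_mult_nonzero[OF assms])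
  then show ?case
    unfolding root_poly_simps pderiv_mult list.map sum_list.Cons
    using Cons by (simp add: pderiv_pCons field_simps)
qed (simp add: pderiv_1)

lemma Im_sum_list: "Im (\<Sum>y\<leftarrow>ys. f y) = (\<Sum>y\<leftarrow>ys. Im (f y))"
  by (induction ys) auto

text \<open>
  Off the real line all terms \<open>y/(1 + yz)\<close> of the logarithmic derivative have imaginary parts of the
  same sign, so the derivative of \<open>\<Prod>(1 + yX)\<close> has no nonreal root and is again such a product.
  The statement compares coefficients.
\<close>
lemma esym_list_pderiv:
  assumes "esym_list 1 ys \<noteq> 0" and "length ys = Suc N"
  shows "\<exists>zs. length zs = N \<and>
    (\<forall>k. real (Suc k) * esym_list (Suc k) ys = esym_list 1 ys * esym_list k zs)"
proof -
  let ?q = "pderiv (root_poly ys)"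
  have q0: "poly ?q 0 = of_real (esym_list 1 ys)"
    by (simp add: poly_0_coeff_0 coeff_pderiv coeff_root_poly)
  have "poly ?q z \<noteq> 0" if z: "Im z \<noteq> 0" for z
  proof -
    have pos: "cmod (1 + of_real y * z) > 0" for y
      using one_plus_real_mult_nonzero[OF z] by simp
    have Im: "Im (of_real y / (1 + of_real y * z)) = - Im z * (y\<^sup>2 / (cmod (1 + of_real y * z))\<^sup>2)" for y
      unfolding cmod_power2 by (simp add: Im_divide power2_eq_square)
    obtain y0 where y0: "y0 \<in> set ys" "y0 \<noteq> 0"
    proof -
      have "\<exists>y\<in>set ys. y \<noteq> 0" using assms(1)
        by (induction ys) auto
      then show ?thesis using that by blast
    qed
    have "(\<Sum>y\<leftarrow>ys. y\<^sup>2 / (cmod (1 + of_real y * z))\<^sup>2) > 0"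
    proof -
      have "0 < y0\<^sup>2 / (cmod (1 + of_real y0 * z))\<^sup>2" using y0 pos[of y0] by simp
      also have "\<dots> \<le> (\<Sum>y\<leftarrow>ys. y\<^sup>2 / (cmod (1 + of_real y * z))\<^sup>2)"
        using y0 by (intro member_le_sum_list) (auto simp: image_iff)
      finally show ?thesis .
    qed
    moreover have "Im (\<Sum>y\<leftarrow>ys. of_real y / (1 + of_real y * z)) =
        - Im z * (\<Sum>y\<leftarrow>ys. y\<^sup>2 / (cmod (1 + of_real y * z))\<^sup>2)"
      unfolding Im_sum_list Im by (rule sum_list_const_mult)
    ultimately have "Im (\<Sum>y\<leftarrow>ys. of_real y / (1 + of_real y * z)) \<noteq> 0" using z by simp
    then have "(\<Sum>y\<leftarrow>ys. of_real y / (1 + of_real y * z)) \<noteq> 0" by force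
    then show ?thesis
      unfolding poly_pderiv_root_poly[OF z] using root_poly_nonreal[OF z] by simp
  qed
  moreover have "degree ?q \<le> N"
    using degree_root_poly[of ys] assms(2) by (simp add: degree_pderiv)
  ultimately obtain zs where zs: "length zs = N" "?q = smult (of_real (esym_list 1 ys)) (root_poly zs)"
    using real_rooted_factorization[of ?q N] q0 assms(1) by auto
  have "of_real (real (Suc k) * esym_list (Suc k) ys) = (of_real (esym_list 1 ys * esym_list k zs) :: complex)" for k
  proof -
    have "coeff ?q k = of_real (real (Suc k) * esym_list (Suc k) ys)"
      by (simp add: coeff_pderiv coeff_root_poly)
    moreover have "coeff ?q k = of_real (esym_list 1 ys * esym_list k zs)"
      unfolding zs(2) by (simp add: coeff_root_poly)
    ultimately show ?thesis by metis
  qed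
  then show ?thesis using zs(1) of_real_eq_iff by blast
qed

text \<open>
  The same argument for the polar derivative \<open>(N+1) p - X p'\<close>, which is the derivative of the reversed
  polynomial: here \<open>p\<close> is multiplied by \<open>\<Sum>1/(1 + yz) = (1/z) \<Sum>z/(1 + yz)\<close>, and the imaginary
  parts of the terms \<open>z/(1 + yz)\<close> all have the sign of \<open>Im z\<close>.
\<close>
lemma esym_list_polar:
  assumes "length ys = Suc N"
  shows "\<exists>zs. length zs = N \<and>
    (\<forall>k. (real (Suc N) - real k) * esym_list k ys = real (Suc N) * esym_list k zs)"
proof -
  let ?p = "root_poly ys"
  let ?q = "smult (of_nat (Suc N)) ?p - pCons 0 (pderiv ?p)"
  have cq: "coeff ?q k = of_real ((real (Suc N) - real k) * esym_list k ys)" for k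
    by (cases k) (simp_all add: coeff_pCons coeff_pderiv coeff_root_poly algebra_simps)
  have q0: "poly ?q 0 = of_nat (Suc N)"
    using cq[of 0] by (simp add: poly_0_coeff_0)
  have "poly ?q z \<noteq> 0" if z: "Im z \<noteq> 0" for z
  proof -
    have nz: "1 + of_real y * z \<noteq> 0" for y by (rule one_plus_real_mult_nonzero[OF z])
    have z0: "z \<noteq> 0" using z by auto
    have pos: "cmod (1 + of_real y * z) > 0" for y using nz by simp
    have one: "1 / (1 + of_real y * z) = 1 - z * (of_real y / (1 + of_real y * z))" for y
      using nz[of y] by (simp add: field_simps)
    have "poly ?q z = poly ?p z * (of_nat (Suc N) - z * (\<Sum>y\<leftarrow>ys. of_real y / (1 + of_real y * z)))"
      by (simp add: poly_pderiv_root_poly[OF z] algebra_simps)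
    also have "of_nat (Suc N) - z * (\<Sum>y\<leftarrow>ys. of_real y / (1 + of_real y * z)) =
        (\<Sum>y\<leftarrow>ys. 1 / (1 + of_real y * z))"
    proof -
      have "(\<Sum>y\<leftarrow>l. 1 / (1 + of_real y * z)) =
        of_nat (length l) - z * (\<Sum>y\<leftarrow>l. of_real y / (1 + of_real y * z))" for l
      proof (induction l)
        case (Cons y l)
        show ?case
          unfolding list.map sum_list.Cons Cons one[of y] by (simp add: algebra_simps)
      qed simp
      then show ?thesis using assms by simp
    qed
    also have "\<dots> = (1 / z) * (\<Sum>y\<leftarrow>ys. z / (1 + of_real y * z))"
      using z0 by (simp add: sum_list_const_mult[symmetric])
    finally have eq: "poly ?q z = poly ?p z * ((1 / z) * (\<Sum>y\<leftarrow>ys. z / (1 + of_real y * z)))" .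
    have Im: "Im (z / (1 + of_real y * z)) = Im z * (1 / (cmod (1 + of_real y * z))\<^sup>2)" for y
      unfolding cmod_power2 by (simp add: Im_divide power2_eq_square algebra_simps)
    have "(\<Sum>y\<leftarrow>ys. 1 / (cmod (1 + of_real y * z))\<^sup>2) > 0"
    proof -
      have "ys \<noteq> []" using assms by auto
      then show ?thesis
      proof (induction ys rule: list_nonempty_induct)
        case (single y)
        then show ?case using pos[of y] by simp
      next
        case (cons y ys)
        then show ?case using pos[of y] by (simp add: add_pos_pos)
      qed
    qed
    moreover have "Im (\<Sum>y\<leftarrow>ys. z / (1 + of_real y * z)) =
        Im z * (\<Sum>y\<leftarrow>ys. 1 / (cmod (1 + of_real y * z))\<^sup>2)"
      unfolding Im_sum_list Im by (rule sum_list_const_mult)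
    ultimately have "Im (\<Sum>y\<leftarrow>ys. z / (1 + of_real y * z)) \<noteq> 0" using z by simp
    then have "(\<Sum>y\<leftarrow>ys. z / (1 + of_real y * z)) \<noteq> 0" by force
    then show ?thesis unfolding eq using root_poly_nonreal[OF z] z0 by simp
  qed
  moreover have "degree ?q \<le> N"
  proof (rule degree_le, intro allI impI)
    fix k assume "N < k"
    then consider "k = Suc N" | "k > degree ?p"
      using degree_root_poly[of ys] assms by force
    then show "coeff ?q k = 0"
    proof cases
      case 2
      then have "esym_list k ys = 0"
        using coeff_root_poly[of ys k] by (simp add: coeff_eq_0)
      then show ?thesis unfolding cq by simp
    next
      case 1
      then show ?thesis unfolding cq by simp
    qed
  qed
  ultimately obtain zs where zs: "length zs = N" "?q = smult (of_nat (Suc N)) (root_poly zs)"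
    using real_rooted_factorization[of ?q N] q0 by (metis of_nat_eq_0_iff Suc_not_Zero)
  have "of_real ((real (Suc N) - real k) * esym_list k ys) = (of_real (real (Suc N) * esym_list k zs) :: complex)" for k
    using cq[of k] unfolding zs(2) by (simp add: coeff_root_poly)
  then show ?thesis using zs(1) of_real_eq_iff by blast
qed

lemma binomial_ratio_Suc:
  assumes "k \<le> N"
  shows "real (Suc N choose k) * (real (Suc N) - real k) = real (Suc N) * real (N choose k)"
proof -
  have "(Suc N - k) * (Suc N choose k) = Suc N * (N choose k)"
    using binomial_absorb_comp[of "Suc N" k] by simp
  then have "real (Suc N - k) * real (Suc N choose k) = real (Suc N) * real (N choose k)"
    by (metis of_nat_mult)
  then show ?thesis using assms by (simp add: of_nat_diff mult.commute)
qed

text \<open>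
  Iterating the polar derivative shortens the list while the elementary symmetric means
  \<open>\<sigma>\<^sub>k / (n choose k)\<close> stay the same.
\<close>
lemma esym_list_reduce:
  assumes "K \<le> length ys"
  shows "\<exists>zs. length zs = K \<and>
    (\<forall>k\<le>K. esym_list k ys / real (length ys choose k) = esym_list k zs / real (K choose k))"
  using assms
proof (induction "length ys" arbitrary: ys)
  case 0
  then show ?case by auto
next
  case (Suc N)
  show ?case
  proof (cases "K = Suc N")
    case True
    then show ?thesis using Suc by auto
  next
    case False
    then have "K \<le> N" using Suc by simp
    obtain xs where xs: "length xs = N"
      "\<And>k. (real (Suc N) - real k) * esym_list k ys = real (Suc N) * esym_list k xs"
      using esym_list_polar[of ys N] Suc.hyps(2) by auto
    obtain zs where zs: "length zs = K"
      "\<forall>k\<le>K. esym_list k xs / real (N choose k) = esym_list k zs / real (K choose k)"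
      using Suc.hyps(1)[of xs] xs(1) \<open>K \<le> N\<close> by auto
    have "esym_list k ys / real (Suc N choose k) = esym_list k xs / real (N choose k)" if "k \<le> K" for k
    proof -
      have "k \<le> N" using that \<open>K \<le> N\<close> by simp
      have p: "real (Suc N choose k) > 0" "real (N choose k) > 0" "real (Suc N) - real k > 0"
        using \<open>k \<le> N\<close> by (auto simp: zero_less_binomial)
      have "(real (Suc N) - real k) * (esym_list k ys * real (N choose k)) =
        (real (Suc N) - real k) * (esym_list k xs * real (Suc N choose k))"
        using xs(2)[of k] binomial_ratio_Suc[OF \<open>k \<le> N\<close>] by algebra
      then have "esym_list k ys * real (N choose k) = esym_list k xs * real (Suc N choose k)"
        using p(3) by (simp only: mult_cancel_left) auto
      then show ?thesis using p by (simp add: frac_eq_eq)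
    qed
    then show ?thesis using zs Suc.hyps(2) by auto
  qed
qed

lemma esym_list_numerals:
  "esym_list 1 [a, b, c] = a + b + c"
  "esym_list 2 [a, b, c] = a * b + a * c + b * c"
  "esym_list 3 [a, b, c] = a * b * c"
  by (simp_all add: numeral_2_eq_2 numeral_3_eq_3 algebra_simps)

section \<open>Criteria for the Garding property\<close>

lemma multi_affine_along_axis:
  assumes "multi_affine f"
  shows "f (w + axis j t) = f w + t * (f (w + axis j 1) - f w)"
proof -
  obtain c where c: "\<And>w. f w = (\<Sum>S\<in>UNIV. c S * (\<Prod>e\<in>S. w $ e))"
    using assms unfolding multi_affine_def by blast
  have prod: "(\<Prod>e\<in>S. (w + axis j t) $ e) =
      (\<Prod>e\<in>S. w $ e) + t * (if j \<in> S then \<Prod>e\<in>S - {j}. w $ e else 0)" for S t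
  proof (cases "j \<in> S")
    case True
    then have "(\<Prod>e\<in>S. (w + axis j t) $ e) = (w $ j + t) * (\<Prod>e\<in>S - {j}. (w + axis j t) $ e)"
      by (subst prod.remove[of S j]) auto
    also have "(\<Prod>e\<in>S - {j}. (w + axis j t) $ e) = (\<Prod>e\<in>S - {j}. w $ e)"
      by (intro prod.cong) (auto simp: axis_def)
    also have "(w $ j + t) * (\<Prod>e\<in>S - {j}. w $ e) = (\<Prod>e\<in>S. w $ e) + t * (\<Prod>e\<in>S - {j}. w $ e)"
      using prod.remove[of S j "($) w"] True by (simp add: distrib_right)
    finally show ?thesis using True by simp
  next
    case False
    then have "(\<Prod>e\<in>S. (w + axis j t) $ e) = (\<Prod>e\<in>S. w $ e)"
      by (intro prod.cong) (auto simp: axis_def)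
    then show ?thesis using False by simp
  qed
  define d where "d = (\<Sum>S\<in>UNIV. c S * (if j \<in> S then \<Prod>e\<in>S - {j}. w $ e else 0))"
  have "f (w + axis j t) = f w + t * d" for t
    unfolding c prod d_def distrib_left sum.distrib sum_distrib_left by (simp add: mult.left_commute)
  from this[of t] this[of 1] show ?thesis by simp
qed

lemma continuous_on_multi_affine:
  assumes "multi_affine f"
  shows "continuous_on S f"
proof -
  obtain c where c: "\<And>w. f w = (\<Sum>S\<in>UNIV. c S * (\<Prod>e\<in>S. w $ e))"
    using assms unfolding multi_affine_def by blast
  show ?thesis unfolding c by (intro continuous_intros)
qed

lemma closure_pos_orthant: "closure pos_orthant = {z :: real ^ 'e::finite. \<forall>i. 0 \<le> z $ i}"
proof
  have "closed {z :: real ^ 'e. \<forall>i. 0 \<le> z $ i}"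
    by (intro closed_Collect_all closed_Collect_le continuous_intros)
  then show "closure pos_orthant \<subseteq> {z :: real ^ 'e. \<forall>i. 0 \<le> z $ i}"
    by (intro closure_minimal) (auto simp: pos_orthant_def less_imp_le)
next
  show "{z :: real ^ 'e. \<forall>i. 0 \<le> z $ i} \<subseteq> closure pos_orthant"
  proof
    fix z :: "real ^ 'e" assume z: "z \<in> {z. \<forall>i. 0 \<le> z $ i}"
    define x :: "nat \<Rightarrow> real ^ 'e" where "x = (\<lambda>n. \<chi> i. z $ i + 1 / real (Suc n))"
    have "x n \<in> pos_orthant" for n
      using z by (auto simp: x_def pos_orthant_def intro!: add_nonneg_pos)
    moreover have "x \<longlonglongrightarrow> z"
    proof (rule vec_tendstoI)
      fix i
      have "(\<lambda>n. z $ i + 1 / real (Suc n)) \<longlonglongrightarrow> z $ i + 0"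
        by (intro tendsto_intros LIMSEQ_Suc lim_1_over_n)
      then show "(\<lambda>n. x n $ i) \<longlonglongrightarrow> z $ i" by (simp add: x_def)
    qed
    ultimately show "z \<in> closure pos_orthant"
      unfolding closure_sequential by blast
  qed
qed

lemma convex_pos_orthant: "convex (pos_orthant :: (real ^ 'e::finite) set)"
  unfolding convex_def pos_orthant_def
  by (auto intro: add_pos_nonneg add_nonneg_pos simp: le_less)

text \<open>
  Let \<open>C\<close> be the component of \<open>{f > 0}\<close> containing the orthant and \<open>U\<close> the region where all barriers
  \<open>g \<in> G\<close> are positive.  By the barrier condition \<open>U\<close> is open and closed relative to \<open>{f > 0}\<close>, hence
  contains \<open>C\<close>.  If \<open>\<partial>\<^sub>j f\<close> vanished at a point of \<open>C\<close>, then \<open>f\<close> would be constant and positive on the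
  line through this point in direction \<open>j\<close>, so the line would lie in \<open>C \<subseteq> U\<close>.  Excluding this makes
  \<open>\<partial>\<^sub>j f\<close> positive on \<open>C\<close>, and moving in direction \<open>j\<close> stays in \<open>C\<close>.
\<close>
lemma garding_criterion:
  fixes f :: "real ^ 'e::finite \<Rightarrow> real" and G :: "(real ^ 'e \<Rightarrow> real) set"
  assumes ma: "multi_affine f" and fin: "finite G"
    and cont: "\<And>g. g \<in> G \<Longrightarrow> continuous_on UNIV g"
    and fpos: "\<And>w. w \<in> pos_orthant \<Longrightarrow> 0 < f w"
    and gpos: "\<And>g w. g \<in> G \<Longrightarrow> w \<in> pos_orthant \<Longrightarrow> 0 < g w"
    and barrier: "\<And>w g. 0 < f w \<Longrightarrow> (\<And>g. g \<in> G \<Longrightarrow> 0 \<le> g w) \<Longrightarrow> g \<in> G \<Longrightarrow> 0 < g w"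
    and lines: "\<And>j. (\<forall>w t. f (w + axis j t) = f w) \<or>
      (\<forall>w. (\<forall>g\<in>G. 0 < g w) \<longrightarrow>
        (\<exists>t. \<not> (0 < f (w + axis j t) \<and> (\<forall>g\<in>G. 0 < g (w + axis j t)))))"
  shows "garding f"
proof -
  define V where "V = {w. 0 < f w}"
  define p :: "real ^ 'e" where "p = (\<chi> i. 1)"
  define C where "C = connected_component_set V p"
  define U where "U = {w. \<forall>g\<in>G. 0 < g w}"
  define K where "K = {w. \<forall>g\<in>G. 0 \<le> g w}"
  have p: "p \<in> pos_orthant" by (simp add: p_def pos_orthant_def)
  have pV: "p \<in> V" using fpos[OF p] by (simp add: V_def)
  have CV: "C \<subseteq> V" unfolding C_def by (rule connected_component_subset)
  have pC: "p \<in> C" using pV by (simp add: C_def)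
  have conn: "connected C" unfolding C_def by (rule connected_connected_component)
  have "C \<in> components V" unfolding C_def components_def using pV by blast
  have into_C: "S \<subseteq> C" if "connected S" "S \<subseteq> V" "w \<in> S" "w \<in> C" for S w
    using \<open>C \<in> components V\<close> that components_maximal[of C V S] by blast
  have "open U"
  proof -
    have "U = (\<Inter>g\<in>G. {w. 0 < g w})" by (auto simp: U_def)
    then show ?thesis using fin cont by (auto intro!: open_INT open_Collect_less continuous_intros)
  qed
  have "closed K"
  proof -
    have "K = (\<Inter>g\<in>G. {w. 0 \<le> g w})" by (auto simp: K_def)
    then show ?thesis using cont by (auto intro!: closed_INT closed_Collect_le continuous_intros)
  qed
  have "V \<inter> K \<subseteq> U" unfolding V_def K_def U_def using barrier by blast
  moreover have "U \<subseteq> K" unfolding K_def U_def by (auto intro: less_imp_le)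
  ultimately have "U \<inter> C = {} \<or> - K \<inter> C = {}"
    using CV connectedD[OF conn \<open>open U\<close> open_Compl[OF \<open>closed K\<close>]] by blast
  moreover have "p \<in> U" using gpos p by (simp add: U_def)
  ultimately have CU: "C \<subseteq> U" using pC \<open>V \<inter> K \<subseteq> U\<close> CV by blast
  have ray: "w + axis j t \<in> C" if w: "w \<in> C" and t: "0 \<le> t" for w j t
  proof -
    define d where "d w = f (w + axis j 1) - f w" for w
    have d: "f (w + axis j t) = f w + t * d w" for w t
      unfolding d_def by (rule multi_affine_along_axis[OF ma])
    have cont_line: "continuous_on S (\<lambda>s. w + axis j s)" for S and w :: "real ^ 'e"
    proof -
      have "(\<lambda>s. w + axis j s) = (\<lambda>s. w + s *\<^sub>R axis j 1)"
        by (auto simp: axis_def vec_eq_iff)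
      then show ?thesis by (simp only:) (intro continuous_intros)
    qed
    have w0: "w = w + axis j 0" for w :: "real ^ 'e" by (simp add: axis_def vec_eq_iff)
    have line_in_C: "range (\<lambda>s. w + axis j s) \<subseteq> C" if "w \<in> C" "d w = 0" for w
    proof (rule into_C[OF _ _ _ \<open>w \<in> C\<close>])
      show "connected (range (\<lambda>s. w + axis j s))"
        by (intro connected_continuous_image cont_line) auto
      show "range (\<lambda>s. w + axis j s) \<subseteq> V"
        using that CV by (auto simp: V_def d)
      show "w \<in> range (\<lambda>s. w + axis j s)" using w0 by blast
    qed
    from lines[of j] show ?thesis
    proof
      assume "\<forall>w t. f (w + axis j t) = f w"
      then have "d w = 0" by (simp add: d_def)
      then show ?thesis using line_in_C[OF w] by blast
    next
      assume *: "\<forall>w. (\<forall>g\<in>G. 0 < g w) \<longrightarrow>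
        (\<exists>t. \<not> (0 < f (w + axis j t) \<and> (\<forall>g\<in>G. 0 < g (w + axis j t))))"
      have nz: "d w \<noteq> 0" if "w \<in> C" for w
      proof
        assume "d w = 0"
        then have "range (\<lambda>s. w + axis j s) \<subseteq> U \<inter> V"
          using line_in_C[OF that] CU CV by blast
        moreover have "\<forall>g\<in>G. 0 < g w" using that CU by (auto simp: U_def)
        ultimately show False using * unfolding U_def V_def by blast
      qed
      \<comment> \<open>a negative derivative at \<open>p\<close> would make \<open>f\<close> vanish at another point of the orthant\<close>
      have "d p > 0"
      proof (rule ccontr)
        assume "\<not> d p > 0"
        then have neg: "d p < 0" using nz[OF pC] by simp
        define s where "s = - f p / d p"
        have "s \<ge> 0" using neg fpos[OF p] by (simp add: s_def divide_nonneg_neg zero_le_divide_iff)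
        then have "p + axis j s \<in> pos_orthant"
          by (auto simp: pos_orthant_def p_def axis_def)
        then have "0 < f p + s * d p" using fpos d by metis
        then show False using neg by (simp add: s_def)
      qed
      have cd: "continuous_on C d"
      proof -
        have "continuous_on C (\<lambda>w. f (w + axis j 1))"
          by (rule continuous_on_compose2[OF continuous_on_multi_affine[OF ma, of UNIV]])
             (auto intro!: continuous_intros)
        then show ?thesis unfolding d_def[abs_def]
          by (intro continuous_on_diff continuous_on_multi_affine[OF ma])
      qed
      have "d w > 0"
      proof (rule ccontr)
        assume "\<not> d w > 0"
        then have "0 \<in> d ` C"
          using connectedD_interval[OF connected_continuous_image[OF cd conn], of "d w" "d p" 0]
            w pC \<open>d p > 0\<close> by auto
        then show False using nz by force
      qed
      have "(\<lambda>s. w + axis j s) ` {0..} \<subseteq> C"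
      proof (rule into_C[OF _ _ _ w])
        show "connected ((\<lambda>s. w + axis j s) ` {0..})"
          by (intro connected_continuous_image cont_line) auto
        show "(\<lambda>s. w + axis j s) ` {0..} \<subseteq> V"
          using w CV \<open>d w > 0\<close> by (auto simp: V_def d intro!: add_pos_nonneg)
        show "w \<in> (\<lambda>s. w + axis j s) ` {0..}" using w0 by (metis atLeast_iff image_eqI order_refl)
      qed
      then show ?thesis using t by auto
    qed
  qed
  have "passes_PRT C"
    unfolding passes_PRT_def
  proof safe
    fix r z :: "real ^ 'e"
    assume r: "r \<in> C" and z: "z \<in> closure pos_orthant"
    have "r + (\<Sum>j\<in>J. axis j (z $ j)) \<in> C" for J
    proof (induction J rule: infinite_finite_induct)
      case (insert j J)
      then show ?case using ray[of "r + (\<Sum>j\<in>J. axis j (z $ j))" "z $ j" j] z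
        by (simp add: closure_pos_orthant add.commute add.left_commute)
    qed (use r in auto)
    from this[of UNIV] have "r + (\<Sum>j\<in>UNIV. axis j (z $ j)) \<in> C" .
    moreover have "(\<Sum>j\<in>UNIV. axis j (z $ j)) = z"
      by (simp add: vec_eq_iff axis_def if_distrib cong: if_cong)
    ultimately show "r + z \<in> C" by simp
  qed
  then show ?thesis
    unfolding garding_def using ma fpos[OF p] \<open>C \<in> components V\<close> unfolding V_def by force
qed

text \<open>
  A set passing the positive ray test meets the orthant, so a component passing the test contains the
  orthant and then every connected subset of \<open>{f > 0}\<close> that meets it.
\<close>
lemma not_garding_criterion:
  fixes f :: "real ^ 'e::finite \<Rightarrow> real"
  assumes fpos: "\<And>w. w \<in> pos_orthant \<Longrightarrow> 0 < f w"
    and T: "connected T" "T \<subseteq> {w. 0 < f w}" "p \<in> T" "p \<in> pos_orthant"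
    and w: "w \<in> T" "\<And>i. 0 \<le> z $ i" "f (w + z) \<le> 0"
  shows "\<not> garding f"
proof
  assume "garding f"
  then obtain C where C: "C \<in> components {w. 0 < f w}" "passes_PRT C"
    by (auto simp: garding_def)
  then obtain r where r: "r \<in> C" using in_components_nonempty by blast
  have shift: "v + x \<in> C" if "v \<in> C" "\<And>i. 0 \<le> x $ i" for v x
    using C(2) that unfolding passes_PRT_def closure_pos_orthant by blast
  define x :: "real ^ 'e" where "x = (\<chi> i. \<bar>r $ i\<bar> + 1)"
  have "r + x \<in> C" by (rule shift[OF r]) (simp add: x_def)
  moreover have "0 < r $ i + (\<bar>r $ i\<bar> + 1)" for i by linarith
  then have "r + x \<in> pos_orthant" by (simp add: pos_orthant_def x_def)
  ultimately have "pos_orthant \<subseteq> C"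
    using fpos C(1) convex_connected[OF convex_pos_orthant]
    by (intro components_maximal[of C "{w. 0 < f w}"]) auto
  then have "T \<subseteq> C"
    using C(1) T by (intro components_maximal[of C "{w. 0 < f w}"]) auto
  then have "w + z \<in> C" using shift w by blast
  then show False using in_components_subset[OF C(1)] w(3) by force
qed

section \<open>Elementary symmetric functions at real points\<close>

lemma real_choose_small:
  "real (n choose 2) = real n * (real n - 1) / 2"
  "real (n choose 3) = real n * (real n - 1) * (real n - 2) / 6"
  "real (n choose 4) = real n * (real n - 1) * (real n - 2) * (real n - 3) / 24"
proof -
  show 2: "real (n choose 2) = real n * (real n - 1) / 2" for n
    by (induction n) (simp_all add: numeral_2_eq_2 field_simps)
  show 3: "real (n choose 3) = real n * (real n - 1) * (real n - 2) / 6" for n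
  proof (induction n)
    case (Suc n)
    have "Suc n choose 3 = (n choose 3) + (n choose 2)" by (simp add: eval_nat_numeral)
    then show ?case using Suc 2[of n] by (simp add: field_simps)
  qed simp
  show "real (n choose 4) = real n * (real n - 1) * (real n - 2) * (real n - 3) / 24" for n
  proof (induction n)
    case (Suc n)
    have "Suc n choose 4 = (n choose 4) + (n choose 3)" by (simp add: eval_nat_numeral)
    then show ?case using Suc 3[of n] by (simp add: field_simps)
  qed simp
qed

lemma esym_0 [simp]: "esym 0 A w = 1"
proof -
  have "{S. S \<subseteq> A \<and> card S = 0} = {{}}" by auto
  then show ?thesis by (simp add: esym_def)
qed

lemma esym_insert:
  assumes "a \<notin> A"
  shows "esym (Suc k) (insert a A) w = esym (Suc k) A w + w $ a * esym k A w"
proof -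
  let ?P = "\<lambda>k A. {S. S \<subseteq> A \<and> card S = k}"
  have split: "?P (Suc k) (insert a A) = ?P (Suc k) A \<union> insert a ` ?P k A"
  proof safe
    fix S assume S: "S \<subseteq> insert a A" "card S = Suc k" "S \<notin> insert a ` ?P k A"
    show "x \<in> A" if "x \<in> S" for x
    proof (rule ccontr)
      assume "x \<notin> A"
      then have "a \<in> S" using S(1) that by auto
      then have "S = insert a (S - {a})" "S - {a} \<in> ?P k A"
        using S by auto
      then show False using S(3) by blast
    qed
  qed (use assms in \<open>auto simp: card_insert_if dest: subsetD\<close>)
  have "esym (Suc k) (insert a A) w =
      (\<Sum>S\<in>?P (Suc k) A. \<Prod>e\<in>S. w $ e) + (\<Sum>S\<in>insert a ` ?P k A. \<Prod>e\<in>S. w $ e)"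
    unfolding esym_def split by (rule sum.union_disjoint) (use assms in auto)
  also have "(\<Sum>S\<in>insert a ` ?P k A. \<Prod>e\<in>S. w $ e) = (\<Sum>S\<in>?P k A. \<Prod>e\<in>insert a S. w $ e)"
    by (subst sum.reindex) (use assms in \<open>auto simp: inj_on_def\<close>)
  also have "\<dots> = w $ a * esym k A w"
    unfolding esym_def sum_distrib_left
    by (intro sum.cong refl, subst prod.insert) (use assms in auto)
  finally show ?thesis by (simp add: esym_def)
qed

lemma esym_empty: "esym (Suc k) {} w = 0"
proof -
  have "{S. S \<subseteq> {} \<and> card S = Suc k} = {}" by auto
  then show ?thesis by (simp add: esym_def)
qed

lemma esym_eq_esym_list: "\<exists>ys. length ys = card A \<and> (\<forall>k. esym k A w = esym_list k ys)"
proof (induction A rule: infinite_finite_induct)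
  case empty
  have "esym k {} w = esym_list k []" for k by (cases k) (simp_all add: esym_empty)
  then show ?case by (metis card.empty list.size(3))
next
  case (insert a A)
  then obtain ys where ys: "length ys = card A" "\<And>k. esym k A w = esym_list k ys" by auto
  have "esym k (insert a A) w = esym_list k (w $ a # ys)" for k
    using insert.hyps by (cases k) (simp_all add: esym_insert ys)
  then show ?case using insert.hyps ys(1) by (metis card_insert_disjoint length_Cons)
qed simp

text \<open>
  For the first three elementary symmetric means, \<open>n\<close> real numbers behave like three.
\<close>
lemma esym_three:
  fixes w :: "real ^ 'e::finite"
  assumes "card A = n" "n \<ge> 3"
  obtains a b c where
    "esym 1 A w = real n * ((a + b + c) / 3)"
    "esym 2 A w = real n * (real n - 1) / 2 * ((a * b + a * c + b * c) / 3)"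
    "esym 3 A w = real n * (real n - 1) * (real n - 2) / 6 * (a * b * c)"
proof -
  obtain ys where ys: "length ys = n" "\<And>k. esym k A w = esym_list k ys"
    using esym_eq_esym_list[of A w] assms(1) by auto
  obtain zs where zs: "length zs = 3"
    "\<And>k. k \<le> 3 \<Longrightarrow> esym_list k ys / real (n choose k) = esym_list k zs / real (3 choose k)"
    using esym_list_reduce[of 3 ys] assms(2) ys(1) by auto
  obtain a b c where abc: "zs = [a, b, c]"
    using zs(1) by (auto simp: numeral_3_eq_3 length_Suc_conv)
  have n: "real n \<ge> 3" using assms(2) by simp
  have e: "esym k A w = real (n choose k) * (esym_list k zs / real (3 choose k))" if "k \<le> 3" for k
  proof -
    have "n choose k > 0" using that assms(2) by (simp add: zero_less_binomial)
    then show ?thesis using zs(2)[OF that] unfolding ys by (simp add: divide_eq_eq mult.commute)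
  qed
  have ch: "(3 choose 2) = (3::nat)" "(3 choose 3) = (1::nat)" by (simp_all add: eval_nat_numeral)
  show ?thesis
    using that[of a b c] e[of 1] e[of 2] e[of 3]
    unfolding abc esym_list_numerals real_choose_small ch by simp
qed

text \<open>
  Four is the first length at which all of \<open>\<sigma>\<^sub>1, \<dots>, \<sigma>\<^sub>4\<close> survive; differentiating \<open>\<Prod>(1 + yX)\<close> once more
  leaves a cubic with the nonzero constant term \<open>\<sigma>\<^sub>1\<close> and three real roots.
\<close>
lemma esym_four:
  fixes w :: "real ^ 'e::finite"
  assumes "card A = n" "n \<ge> 4" and nz: "esym 1 A w \<noteq> 0"
  obtains a b c p where
    "esym 1 A w = real n * p"
    "esym 2 A w = real n * (real n - 1) / 2 * (p * ((a + b + c) / 3))"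
    "esym 3 A w = real n * (real n - 1) * (real n - 2) / 6 * (p * ((a * b + a * c + b * c) / 3))"
    "esym 4 A w = real n * (real n - 1) * (real n - 2) * (real n - 3) / 24 * (p * (a * b * c))"
proof -
  obtain ys where ys: "length ys = n" "\<And>k. esym k A w = esym_list k ys"
    using esym_eq_esym_list[of A w] assms(1) by auto
  obtain zs where zs: "length zs = 4"
    "\<And>k. k \<le> 4 \<Longrightarrow> esym_list k ys / real (n choose k) = esym_list k zs / real (4 choose k)"
    using esym_list_reduce[of 4 ys] assms(2) ys(1) by auto
  have n: "real n \<ge> 4" using assms(2) by simp
  define p where "p = esym_list 1 zs / 4"
  have p: "esym_list 1 zs = 4 * p" by (simp add: p_def)
  have e: "esym k A w = real (n choose k) * (esym_list k zs / real (4 choose k))" if "k \<le> 4" for k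
  proof -
    have "n choose k > 0" using that assms(2) by (simp add: zero_less_binomial)
    then show ?thesis using zs(2)[OF that] unfolding ys by (simp add: divide_eq_eq mult.commute)
  qed
  have "esym_list 1 zs \<noteq> 0" using e[of 1] nz by auto
  then obtain xs where xs: "length xs = 3"
    "\<And>k. real (Suc k) * esym_list (Suc k) zs = esym_list 1 zs * esym_list k xs"
    using esym_list_pderiv[of zs 3] zs(1) by auto
  obtain a b c where abc: "xs = [a, b, c]"
    using xs(1) by (auto simp: numeral_3_eq_3 length_Suc_conv)
  have num: "Suc 1 = 2" "Suc 2 = 3" "Suc 3 = 4" by simp_all
  have z: "esym_list 2 zs = 2 * p * (a + b + c)"
    "esym_list 3 zs = 4 / 3 * p * (a * b + a * c + b * c)"
    "esym_list 4 zs = p * (a * b * c)"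
    using xs(2)[of 1, unfolded num] xs(2)[of 2, unfolded num] xs(2)[of 3, unfolded num]
    unfolding abc p esym_list_numerals by simp_all
  have ch: "(4 choose 2) = (6::nat)" "(4 choose 3) = (4::nat)" "(4 choose 4) = (1::nat)"
    by (simp_all add: eval_nat_numeral)
  show ?thesis
    using that[of p a b c] e[of 1] e[of 2] e[of 3] e[of 4]
    unfolding p z real_choose_small ch by (simp add: mult.assoc)
qed

lemma sum_squares_esym: "(\<Sum>e\<in>A. (w $ e)\<^sup>2) = (esym 1 A w)\<^sup>2 - 2 * esym 2 A w"
proof (induction A rule: infinite_finite_induct)
  case empty
  then show ?case by (simp add: esym_empty[of 0, simplified] esym_empty[of 1, simplified] numeral_2_eq_2 esym_empty)
next
  case (insert a A)
  have "esym 1 (insert a A) w = esym 1 A w + w $ a"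
    using esym_insert[OF insert.hyps(2), of 0 w] by simp
  moreover have "esym 2 (insert a A) w = esym 2 A w + w $ a * esym 1 A w"
    using esym_insert[OF insert.hyps(2), of 1 w] by (simp add: numeral_2_eq_2)
  ultimately show ?case using insert by (simp add: power2_eq_square algebra_simps)
qed simp

lemma esym_1: "esym 1 A w = (\<Sum>e\<in>A. w $ e)"
proof (induction A rule: infinite_finite_induct)
  case empty
  then show ?case by (simp add: esym_empty)
next
  case (insert a A)
  then show ?case using esym_insert[of a A 0 w] by simp
qed simp

lemma esym_eq_0:
  assumes "\<And>e. e \<in> A \<Longrightarrow> w $ e = 0" "k > 0"
  shows "esym k A w = 0"
  unfolding esym_def
proof (intro sum.neutral ballI)
  fix S assume "S \<in> {S. S \<subseteq> A \<and> card S = k}"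
  then have "S \<subseteq> A" "S \<noteq> {}" using assms(2) by auto
  then obtain e where "e \<in> S" "w $ e = 0" using assms(1) by blast
  then show "(\<Prod>e\<in>S. w $ e) = 0" by (metis finite prod_zero_iff)
qed

text \<open>
  With \<open>\<sigma>\<^sub>1 = 0\<close> the number \<open>-2 \<sigma>\<^sub>2\<close> is a sum of squares.
\<close>
lemma esym_1_le_0:
  assumes "esym 1 A w = 0"
  shows "esym 2 A w \<le> 0" and "esym 2 A w = 0 \<Longrightarrow> k > 0 \<Longrightarrow> esym k A w = 0"
proof -
  have *: "(\<Sum>e\<in>A. (w $ e)\<^sup>2) = - 2 * esym 2 A w"
    using sum_squares_esym[of w A] assms by simp
  have "0 \<le> (\<Sum>e\<in>A. (w $ e)\<^sup>2)" by (intro sum_nonneg) auto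
  with * show "esym 2 A w \<le> 0" by simp
  assume "esym 2 A w = 0" and k: "k > 0"
  with * have "(\<Sum>e\<in>A. (w $ e)\<^sup>2) = 0" by simp
  then have "\<forall>e\<in>A. (w $ e)\<^sup>2 = 0" by (subst (asm) sum_nonneg_eq_0_iff) auto
  then show "esym k A w = 0" using k by (intro esym_eq_0) auto
qed

section \<open>Inequalities for three real numbers\<close>

lemma newton_three_12: "(a * b + a * c + b * c) / 3 \<le> ((a + b + c) / 3)\<^sup>2" for a b c :: real
proof -
  have "((a + b + c) / 3)\<^sup>2 - (a * b + a * c + b * c) / 3 = ((a - b)\<^sup>2 + (a - c)\<^sup>2 + (b - c)\<^sup>2) / 18"
    by (simp add: power2_eq_square field_simps)
  moreover have "0 \<le> ((a - b)\<^sup>2 + (a - c)\<^sup>2 + (b - c)\<^sup>2) / 18" by simp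
  ultimately show ?thesis by linarith
qed

lemma newton_three_23: "(a + b + c) / 3 * (a * b * c) \<le> ((a * b + a * c + b * c) / 3)\<^sup>2" for a b c :: real
  using newton_three_12[of "a * b" "a * c" "b * c"] by (simp add: algebra_simps power2_eq_square)

lemma three_eq_0:
  fixes a b c :: real
  assumes "a + b + c = 0" "a * b + a * c + b * c = 0"
  shows "a = 0" "b = 0" "c = 0"
proof -
  have "a\<^sup>2 + b\<^sup>2 + c\<^sup>2 = (a + b + c)\<^sup>2 - 2 * (a * b + a * c + b * c)"
    by (simp add: power2_eq_square algebra_simps)
  then have "a\<^sup>2 + (b\<^sup>2 + c\<^sup>2) = 0" using assms by simp
  then have "a\<^sup>2 = 0 \<and> b\<^sup>2 + c\<^sup>2 = 0" by (subst (asm) add_nonneg_eq_0_iff) auto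
  then show "a = 0" "b = 0" "c = 0" by auto
qed

text \<open>
  The factor \<open>3/4\<close> improves Newton's inequality on the region \<open>\<sigma>\<^sub>2 \<le> 0\<close>: there at least one of the three
  products of two entries is nonpositive, and the identity \<open>id\<close> then exhibits
  \<open>\<sigma>\<^sub>2\<^sup>2 - 4 \<sigma>\<^sub>1 \<sigma>\<^sub>3\<close> as a nonnegative number.
\<close>
lemma newton_three_improved:
  fixes a b c :: real
  assumes "a * b + a * c + b * c \<le> 0"
  shows "(a + b + c) / 3 * (a * b * c) \<le> 3 / 4 * ((a * b + a * c + b * c) / 3)\<^sup>2"
proof -
  have id: "(x * y + x * z + y * z)\<^sup>2 - 4 * (x + y + z) * (x * y * z) =
      (x * (y + z) - y * z)\<^sup>2 - 4 * x\<^sup>2 * (y * z)" for x y z :: real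
    by (simp add: power2_eq_square algebra_simps)
  have *: "0 \<le> (x * y + x * z + y * z)\<^sup>2 - 4 * (x + y + z) * (x * y * z)" if "y * z \<le> 0" for x y z :: real
  proof -
    have "x\<^sup>2 * (y * z) \<le> 0" using that by (simp add: mult_nonneg_nonpos)
    then show ?thesis unfolding id using zero_le_power2[of "x * (y + z) - y * z"] by linarith
  qed
  have "a * b \<le> 0 \<or> a * c \<le> 0 \<or> b * c \<le> 0"
    using assms by linarith
  then have "0 \<le> (a * b + a * c + b * c)\<^sup>2 - 4 * (a + b + c) * (a * b * c)"
    using *[of a b c] *[of a c b] *[of b c a] by (auto simp: algebra_simps)
  then show ?thesis by (simp add: power2_eq_square field_simps)
qed

text \<open>
  The sharp bound for a product with prescribed mean \<open>m\<close> and variance \<open>2d\<^sup>2\<close>, attained at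
  \<open>(m-d, m-d, m+2d)\<close>.  It expresses that the discriminant of the cubic with roots \<open>a - m\<close>, \<open>b - m\<close>,
  \<open>c - m\<close>, being the square of the product of the root differences, is nonnegative.
\<close>
lemma three_product_le:
  fixes a b c d :: real
  defines "m \<equiv> (a + b + c) / 3"
  assumes "0 \<le> d" "d\<^sup>2 = m\<^sup>2 - (a * b + a * c + b * c) / 3"
  shows "a * b * c \<le> (d - m)\<^sup>2 * (2 * d + m)"
proof -
  define u v x where "u = a - m" "v = b - m" "x = c - m"
  have s: "x = - u - v" by (simp add: u_v_x_def m_def field_simps)
  have abc: "a = m + u" "b = m + v" "c = m - u - v" using s by (simp_all add: u_v_x_def)
  have d2: "3 * d\<^sup>2 = u\<^sup>2 + u * v + v\<^sup>2"
    using assms(3) unfolding abc by (simp add: power2_eq_square field_simps)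
  have "0 \<le> ((u - v) * (2 * u + v) * (u + 2 * v))\<^sup>2" by simp
  also have "\<dots> = 4 * (u\<^sup>2 + u * v + v\<^sup>2) ^ 3 - 27 * (u * v * (u + v))\<^sup>2"
    by (simp add: power2_eq_square power3_eq_cube algebra_simps)
  also have "\<dots> = 27 * ((2 * d ^ 3)\<^sup>2 - (u * v * (u + v))\<^sup>2)"
    unfolding d2[symmetric] by (simp add: power2_eq_square power3_eq_cube algebra_simps)
  finally have "(u * v * (u + v))\<^sup>2 \<le> (2 * d ^ 3)\<^sup>2" by simp
  then have "\<bar>u * v * (u + v)\<bar> \<le> \<bar>2 * d ^ 3\<bar>"
    by (rule iffD2[OF abs_le_square_iff])
  also have "\<bar>2 * d ^ 3\<bar> = 2 * d ^ 3" using assms(2) by simp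
  finally have "\<bar>u * v * (u + v)\<bar> \<le> 2 * d ^ 3" .
  then have "- (u * v * (u + v)) \<le> 2 * d ^ 3" by linarith
  moreover have "a * b * c = m ^ 3 - m * (3 * d\<^sup>2) - u * v * (u + v)"
    unfolding abc d2 by (simp add: power2_eq_square power3_eq_cube algebra_simps)
  moreover have "(d - m)\<^sup>2 * (2 * d + m) = m ^ 3 - m * (3 * d\<^sup>2) + 2 * d ^ 3"
    by (simp add: power2_eq_square power3_eq_cube algebra_simps)
  ultimately show ?thesis by linarith
qed

text \<open>
  The cubic \<open>(t - b)\<^sup>2 (2t + b)\<close> arises twice, at \<open>t = d\<close> as the sharp upper bound for \<open>\<sigma>\<^sub>4\<close> (see
  \<open>three_product_le\<close>) and at \<open>t = w\<close> from the equation \<open>D = 0\<close> (see \<open>shifted_cubic_le\<close>).  The two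
  arguments satisfy \<open>w\<^sup>2 - b\<^sup>2 = \<theta> (d\<^sup>2 - b\<^sup>2)\<close>.  For \<open>b \<le> 0\<close> and \<open>d\<^sup>2 < b\<^sup>2\<close> the cubic is increasing
  and \<open>d \<le> w\<close>.  In the other cases write
  \<open>(t - b)\<^sup>2 (2t + b) = (t\<^sup>2 - b\<^sup>2)\<^sup>2 (2t + b)/(t + b)\<^sup>2\<close>, so that the first factor contributes \<open>\<theta>\<^sup>2\<close>: for
  \<open>b\<^sup>2 \<le> d\<^sup>2\<close> the function \<open>(2t + b)/(t + b)\<^sup>2\<close> is decreasing and \<open>w \<le> d\<close>, and for \<open>0 \<le> d < b\<close> it is
  \<open>(b - t)(b + t)\<^sup>3/(b + 2t)\<close> that decreases, which costs one more factor \<open>\<theta>\<close>.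
\<close>
lemma cubic_comparison:
  fixes b d w \<theta> :: real
  assumes th: "0 < \<theta>" "\<theta> \<le> 1" and nn: "0 \<le> d" "0 \<le> w"
    and eq: "w\<^sup>2 - b\<^sup>2 = \<theta> * (d\<^sup>2 - b\<^sup>2)" and neg: "- b \<le> 2 * d"
  shows "\<theta> ^ 3 * ((d - b)\<^sup>2 * (2 * d + b)) \<le> (w - b)\<^sup>2 * (2 * w + b)"
proof -
  have th3: "\<theta> ^ 3 \<le> 1" "0 < \<theta> ^ 3" using th by (auto simp: power_le_one)
  have G0: "0 \<le> (d - b)\<^sup>2 * (2 * d + b)" using neg by simp
  have weaken: ?thesis if "(d - b)\<^sup>2 * (2 * d + b) \<le> (w - b)\<^sup>2 * (2 * w + b)"
    using mult_left_mono[OF th3(1) G0] that by (simp add: mult.commute)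
  consider "b \<le> 0" "d\<^sup>2 < b\<^sup>2" | "b > 0" "d\<^sup>2 < b\<^sup>2" | "b\<^sup>2 \<le> d\<^sup>2" by linarith
  then show ?thesis
  proof cases
    case 1
    have "(1 - \<theta>) * (d\<^sup>2 - b\<^sup>2) \<le> 0" using 1 th by (intro mult_nonneg_nonpos) auto
    then have "d\<^sup>2 \<le> w\<^sup>2" using eq by (simp add: algebra_simps)
    then have dw: "d \<le> w" using nn power2_le_imp_le by blast
    have "(d - b)\<^sup>2 * (2 * d + b) \<le> (w - b)\<^sup>2 * (2 * w + b)"
      using dw nn 1 neg by (intro mult_mono power_mono) auto
    then show ?thesis by (rule weaken)
  next
    case 2
    have db: "d < b" using 2 nn by (simp add: power2_less_imp_less)
    have "(1 - \<theta>) * (d\<^sup>2 - b\<^sup>2) \<le> 0" using 2 th by (intro mult_nonneg_nonpos) auto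
    then have "d\<^sup>2 \<le> w\<^sup>2" using eq by (simp add: algebra_simps)
    then have dw: "d \<le> w" using nn power2_le_imp_le by blast
    have "\<theta> * (d\<^sup>2 - b\<^sup>2) < 0" using 2 th by (simp add: mult_pos_neg)
    then have wb: "w < b" using eq 2 by (simp add: power2_less_imp_less)
    \<comment> \<open>\<open>(w - d) R\<close> is the cross-multiplied difference of \<open>(b - t)(b + t)\<^sup>3/(b + 2t)\<close> at \<open>t = d\<close> and \<open>t = w\<close>\<close>
    define R where "R = 2 * b\<^sup>2 * (w\<^sup>2 + w * d + d\<^sup>2) + b * ((w + d) * (w\<^sup>2 + d\<^sup>2)) +
      4 * b * w * d * (w + d) + 2 * w * d * (w\<^sup>2 + w * d + d\<^sup>2)"
    have "0 \<le> R" unfolding R_def using nn 2 by (intro add_nonneg_nonneg mult_nonneg_nonneg) auto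
    then have "0 \<le> (w - d) * R" using dw by simp
    also have "(w - d) * R = (2 * w + b) * ((b + d) ^ 3 * (b - d)) - (2 * d + b) * ((b + w) ^ 3 * (b - w))"
      by (simp add: R_def power2_eq_square power3_eq_cube algebra_simps)
    finally have key: "(2 * d + b) * ((b + w) ^ 3 * (b - w)) \<le> (2 * w + b) * ((b + d) ^ 3 * (b - d))"
      by simp
    define P where "P = (b + d) ^ 3 * (b - d) * (b + w)\<^sup>2"
    have P: "P > 0" unfolding P_def using 2 db nn by (intro mult_pos_pos) auto
    have e1: "(b - w) * (b + w) = \<theta> * ((b - d) * (b + d))"
      using eq by (simp add: power2_eq_square algebra_simps)
    have e1': "\<theta> ^ 2 * ((b - d) * (b + d))\<^sup>2 = ((b - w) * (b + w))\<^sup>2"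
      unfolding e1 by (simp add: power_mult_distrib)
    have "P * (\<theta> ^ 3 * ((d - b)\<^sup>2 * (2 * d + b))) =
        (\<theta> * ((b - d) * (b + d))) * (\<theta> ^ 2 * ((b - d) * (b + d))\<^sup>2) * ((2 * d + b) * (b + w)\<^sup>2)"
      by (simp add: P_def power2_eq_square power3_eq_cube algebra_simps)
    also have "\<dots> = ((b - w) * (b + w))\<^sup>2 * ((2 * d + b) * ((b + w) ^ 3 * (b - w)))"
      unfolding e1' e1[symmetric] by (simp add: power2_eq_square power3_eq_cube algebra_simps)
    also have "\<dots> \<le> ((b - w) * (b + w))\<^sup>2 * ((2 * w + b) * ((b + d) ^ 3 * (b - d)))"
      by (rule mult_left_mono[OF key]) simp
    also have "\<dots> = P * ((w - b)\<^sup>2 * (2 * w + b))"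
      by (simp add: P_def power2_eq_square power3_eq_cube algebra_simps)
    finally show ?thesis using P by simp
  next
    case 3
    have "0 \<le> \<theta> * (d\<^sup>2 - b\<^sup>2)" using 3 th by simp
    then have "b\<^sup>2 \<le> w\<^sup>2" using eq by simp
    then have bw: "\<bar>b\<bar> \<le> w" using nn by (simp add: abs_le_square_iff[symmetric])
    have bd: "\<bar>b\<bar> \<le> d" using 3 nn by (simp add: abs_le_square_iff[symmetric])
    have "0 \<le> (1 - \<theta>) * (d\<^sup>2 - b\<^sup>2)" using 3 th by simp
    then have "w\<^sup>2 \<le> d\<^sup>2" using eq by (simp add: algebra_simps)
    then have wd: "w \<le> d" using nn power2_le_imp_le by blast
    show ?thesis
    proof (cases "w + b = 0 \<or> d + b = 0")
      case True
      then have "w = - b \<and> d = - b"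
      proof
        assume wb: "w + b = 0"
        then have "w\<^sup>2 = b\<^sup>2" by (simp add: eq_neg_iff_add_eq_0[symmetric])
        then have "\<theta> * (d\<^sup>2 - b\<^sup>2) = 0" using eq by simp
        then have "d\<^sup>2 = w\<^sup>2" using th \<open>w\<^sup>2 = b\<^sup>2\<close> by simp
        then have "d = w" using nn by (simp add: power2_eq_iff_nonneg)
        then show ?thesis using wb by simp
      next
        assume "d + b = 0"
        then show ?thesis using bw wd by linarith
      qed
      then show ?thesis by (intro weaken) auto
    next
      case False
      then have pos: "w + b > 0" "d + b > 0" using bw bd by linarith+
      have "0 \<le> (d - w) * ((w + b) * d + (d + b) * w)"
        using wd pos nn by simp
      also have "\<dots> = (2 * w + b) * (d + b)\<^sup>2 - (2 * d + b) * (w + b)\<^sup>2"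
        by (simp add: power2_eq_square algebra_simps)
      finally have key: "(2 * d + b) * (w + b)\<^sup>2 \<le> (2 * w + b) * (d + b)\<^sup>2" by simp
      define P where "P = (d + b)\<^sup>2 * (w + b)\<^sup>2"
      have P: "P > 0" unfolding P_def using pos by simp
      have th2: "\<theta> ^ 3 \<le> \<theta> ^ 2" using th by (intro power_decreasing) auto
      have e1': "(\<theta> * (d\<^sup>2 - b\<^sup>2))\<^sup>2 = (w\<^sup>2 - b\<^sup>2)\<^sup>2" unfolding eq ..
      have "P * (\<theta> ^ 3 * ((d - b)\<^sup>2 * (2 * d + b))) \<le> P * (\<theta> ^ 2 * ((d - b)\<^sup>2 * (2 * d + b)))"
        using P th2 G0 by (intro mult_left_mono mult_right_mono) auto
      also have "\<dots> = (\<theta> * (d\<^sup>2 - b\<^sup>2))\<^sup>2 * ((2 * d + b) * (w + b)\<^sup>2)"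
        by (simp add: P_def power2_eq_square algebra_simps)
      also have "\<dots> \<le> (w\<^sup>2 - b\<^sup>2)\<^sup>2 * ((2 * w + b) * (d + b)\<^sup>2)"
        unfolding e1' by (rule mult_left_mono[OF key]) simp
      also have "\<dots> = P * ((w - b)\<^sup>2 * (2 * w + b))"
        by (simp add: P_def power2_eq_square algebra_simps)
      finally show ?thesis using P by simp
    qed
  qed
qed

text \<open>
  Translation by \<open>a\<close> turns the hypothesis into \<open>t\<^sub>2 = z\<^sup>2\<close> and the left hand side into
  \<open>t\<^sub>3 - 3 z\<^sup>2 t\<^sub>1 + 3 a z\<^sup>2 - a\<^sup>3\<close>, where \<open>t\<^sub>1, t\<^sub>2, t\<^sub>3\<close> are the symmetric means of the translated
  triple.  Given \<open>t\<^sub>2\<close>, Newton's inequalities show that \<open>t\<^sub>3 - 3 z\<^sup>2 t\<^sub>1\<close> is largest when the triple is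
  constant, equal to \<open>z\<close>; the cubic in the conclusion is the value in that case.
\<close>
lemma shifted_cubic_le:
  fixes x y v a z :: real
  defines "q1 \<equiv> (x + y + v) / 3" and "q2 \<equiv> (x * y + x * v + y * v) / 3" and "q3 \<equiv> x * y * v"
  assumes z: "0 \<le> z" and q1: "0 \<le> q1 + a" and q2: "q2 + 2 * a * q1 + a\<^sup>2 = z\<^sup>2"
  shows "q3 + 3 * a * q2 + 3 * (a\<^sup>2 - z\<^sup>2) * q1 \<le> - ((z - a)\<^sup>2 * (2 * z + a))"
proof -
  define t1 where "t1 = ((x + a) + (y + a) + (v + a)) / 3"
  define t2 where "t2 = ((x + a) * (y + a) + (x + a) * (v + a) + (y + a) * (v + a)) / 3"
  define t3 where "t3 = (x + a) * (y + a) * (v + a)"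
  have t1: "t1 = q1 + a" by (simp add: t1_def q1_def field_simps)
  have t2: "t2 = z\<^sup>2" unfolding q2[symmetric]
    by (simp add: t2_def q1_def q2_def power2_eq_square field_simps)
  have t3: "t3 = q3 + 3 * a * q2 + 3 * a\<^sup>2 * q1 + a ^ 3"
    by (simp add: t3_def q1_def q2_def q3_def power2_eq_square power3_eq_cube field_simps)
  have n1: "t2 \<le> t1\<^sup>2" unfolding t1_def t2_def by (rule newton_three_12)
  have n2: "t1 * t3 \<le> t2\<^sup>2" unfolding t1_def t2_def t3_def by (rule newton_three_23)
  have "0 \<le> t1" using q1 t1 by simp
  with n1 have zt: "z \<le> t1" unfolding t2 by (rule power2_le_imp_le)
  have "t3 - 3 * z\<^sup>2 * t1 + 2 * z ^ 3 \<le> 0"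
  proof (cases "t1 = 0")
    case True
    then have "z = 0" using zt z by simp
    then have "t2 = 0" using t2 by simp
    then have "(x + a) * (y + a) + (x + a) * (v + a) + (y + a) * (v + a) = 0"
      unfolding t2_def by (simp only: divide_eq_0_iff) simp
    moreover have "(x + a) + (y + a) + (v + a) = 0"
      using True unfolding t1_def by (simp only: divide_eq_0_iff) simp
    ultimately have "x + a = 0" by (rule three_eq_0(1)[rotated])
    then have "t3 = 0" by (simp add: t3_def)
    then show ?thesis using \<open>z = 0\<close> by simp
  next
    case False
    then have pos: "0 < t1" using q1 t1 by simp
    have "0 \<le> z\<^sup>2 * ((t1 - z) * (z + 3 * t1))" using zt z pos by simp
    also have "\<dots> = t1 * (3 * z\<^sup>2 * t1 - 2 * z ^ 3) - (z\<^sup>2)\<^sup>2"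
      by (simp add: power2_eq_square power3_eq_cube algebra_simps)
    finally have "t1 * t3 \<le> t1 * (3 * z\<^sup>2 * t1 - 2 * z ^ 3)" using n2 unfolding t2 by linarith
    then show ?thesis using pos by simp
  qed
  then show ?thesis
    unfolding t1 t3 by (simp add: power2_eq_square power3_eq_cube algebra_simps)
qed

section \<open>Newton inequalities for real points\<close>

lemma esym_vanish:
  assumes "esym 1 A w = 0" "0 \<le> esym 2 A w" "k > 0"
  shows "esym k A w = 0"
  using esym_1_le_0[OF assms(1)] assms(2,3) by fastforce

lemma esym_13_newton:
  fixes w :: "real ^ 'e::finite"
  assumes "3 \<le> card A"
  shows "3 * (real (card A) - 1) * (esym 1 A w * esym 3 A w) \<le> 2 * (real (card A) - 2) * (esym 2 A w)\<^sup>2"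
proof -
  define n where "n = real (card A)"
  have n: "n \<ge> 3" using assms by (simp add: n_def)
  obtain a b c where e: "esym 1 A w = n * ((a + b + c) / 3)"
    "esym 2 A w = n * (n - 1) / 2 * ((a * b + a * c + b * c) / 3)"
    "esym 3 A w = n * (n - 1) * (n - 2) / 6 * (a * b * c)"
    using esym_three[OF refl assms(1), of w] unfolding n_def by metis
  define M where "M = n\<^sup>2 * (n - 1)\<^sup>2 * (n - 2) / 2"
  define q1 q2 q3 where "q1 = (a + b + c) / 3" "q2 = (a * b + a * c + b * c) / 3" "q3 = a * b * c"
  have "M \<ge> 0" using n by (simp add: M_def)
  then have "M * (q1 * q3) \<le> M * q2\<^sup>2"
    unfolding q1_q2_q3_def by (intro mult_left_mono newton_three_23)
  moreover have "3 * (n - 1) * (esym 1 A w * esym 3 A w) = M * (q1 * q3)"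
    unfolding e[folded q1_q2_q3_def] M_def
    by (simp add: power2_eq_square, (simp add: algebra_simps)?)
  moreover have "2 * (n - 2) * (esym 2 A w)\<^sup>2 = M * q2\<^sup>2"
    unfolding e[folded q1_q2_q3_def] M_def
    by (simp add: power2_eq_square, (simp add: algebra_simps)?)
  ultimately show ?thesis unfolding n_def by simp
qed

lemma esym_2_le:
  fixes w :: "real ^ 'e::finite"
  assumes "3 \<le> card A"
  shows "2 * real (card A) * esym 2 A w \<le> (real (card A) - 1) * (esym 1 A w)\<^sup>2"
proof -
  define n where "n = real (card A)"
  have n: "n \<ge> 3" using assms by (simp add: n_def)
  obtain a b c where e: "esym 1 A w = n * ((a + b + c) / 3)"
    "esym 2 A w = n * (n - 1) / 2 * ((a * b + a * c + b * c) / 3)"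
    using esym_three[OF refl assms, of w] unfolding n_def by metis
  define q1 q2 where "q1 = (a + b + c) / 3" "q2 = (a * b + a * c + b * c) / 3"
  have "n\<^sup>2 * (n - 1) * q2 \<le> n\<^sup>2 * (n - 1) * q1\<^sup>2"
    unfolding q1_q2_def using n by (intro mult_left_mono newton_three_12) auto
  moreover have "2 * n * esym 2 A w = n\<^sup>2 * (n - 1) * q2"
    unfolding e[folded q1_q2_def] by (simp add: power2_eq_square)
  moreover have "(n - 1) * (esym 1 A w)\<^sup>2 = n\<^sup>2 * (n - 1) * q1\<^sup>2"
    unfolding e[folded q1_q2_def] by (simp add: power2_eq_square)
  ultimately show ?thesis unfolding n_def[symmetric] by linarith
qed

lemma esym_24_le:
  fixes w :: "real ^ 'e::finite"
  assumes "4 \<le> card A" and "0 < esym 1 A w"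
  shows "4 * (real (card A) - 2) * (esym 2 A w * esym 4 A w) \<le> 3 * (real (card A) - 3) * (esym 3 A w)\<^sup>2"
proof -
  define n where "n = real (card A)"
  have n: "n \<ge> 4" using assms by (simp add: n_def)
  have nz: "esym 1 A w \<noteq> 0" using assms by simp
  obtain a b c p where e:
    "esym 2 A w = n * (n - 1) / 2 * (p * ((a + b + c) / 3))"
    "esym 3 A w = n * (n - 1) * (n - 2) / 6 * (p * ((a * b + a * c + b * c) / 3))"
    "esym 4 A w = n * (n - 1) * (n - 2) * (n - 3) / 24 * (p * (a * b * c))"
    using esym_four[OF refl assms(1) nz] unfolding n_def by metis
  define M where "M = (n * (n - 1) * (n - 2) * p)\<^sup>2 * (n - 3) / 12"
  define q1 q2 q3 where "q1 = (a + b + c) / 3" "q2 = (a * b + a * c + b * c) / 3" "q3 = a * b * c"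
  have "M \<ge> 0" using n by (simp add: M_def)
  then have "M * (q1 * q3) \<le> M * q2\<^sup>2"
    unfolding q1_q2_q3_def by (intro mult_left_mono newton_three_23)
  moreover have "4 * (n - 2) * (esym 2 A w * esym 4 A w) = M * (q1 * q3)"
    unfolding e[folded q1_q2_q3_def] M_def
    by (simp add: power2_eq_square, (simp add: algebra_simps)?)
  moreover have "3 * (n - 3) * (esym 3 A w)\<^sup>2 = M * q2\<^sup>2"
    unfolding e[folded q1_q2_q3_def] M_def
    by (simp add: power2_eq_square, (simp add: algebra_simps)?)
  ultimately show ?thesis unfolding n_def by simp
qed

text \<open>
  Once \<open>\<sigma>\<^sub>1 > 0\<close>, the functions \<open>\<sigma>\<^sub>2\<close> and \<open>\<sigma>\<^sub>3\<close> behave as on the nested hyperbolicity cones of the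
  elementary symmetric polynomials: where one of them first reaches \<open>0\<close>, the next one is nonpositive.
\<close>
lemma esym_2_eq_0:
  fixes w :: "real ^ 'e::finite"
  assumes "4 \<le> card A" and "0 < esym 1 A w" and "esym 2 A w = 0"
  shows "esym 3 A w \<le> 0" and "esym 3 A w = 0 \<Longrightarrow> esym 4 A w = 0"
proof -
  define n where "n = real (card A)"
  have n: "n \<ge> 4" using assms by (simp add: n_def)
  have nz: "esym 1 A w \<noteq> 0" using assms by simp
  obtain a b c p where e:
    "esym 1 A w = n * p"
    "esym 2 A w = n * (n - 1) / 2 * (p * ((a + b + c) / 3))"
    "esym 3 A w = n * (n - 1) * (n - 2) / 6 * (p * ((a * b + a * c + b * c) / 3))"
    "esym 4 A w = n * (n - 1) * (n - 2) * (n - 3) / 24 * (p * (a * b * c))"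
    using esym_four[OF refl assms(1) nz] unfolding n_def by metis
  have p: "p > 0" using assms(2) n unfolding e by (simp add: zero_less_mult_iff)
  have s: "a + b + c = 0" using assms(3) n p unfolding e by simp
  have "(a * b + a * c + b * c) / 3 \<le> 0" using newton_three_12[of a b c] s by simp
  then show "esym 3 A w \<le> 0" unfolding e using n p by (intro mult_nonneg_nonpos) auto
  assume "esym 3 A w = 0"
  then have "a * b + a * c + b * c = 0" using n p unfolding e by simp
  with s have "a = 0" by (rule three_eq_0)
  then show "esym 4 A w = 0" unfolding e by simp
qed

lemma esym_3_eq_0:
  fixes w :: "real ^ 'e::finite"
  assumes "4 \<le> card A" and "0 < esym 1 A w" and "0 < esym 2 A w" and "esym 3 A w = 0"
  shows "esym 4 A w \<le> 0"
proof -
  have "(4 * (real (card A) - 2) * esym 2 A w) * esym 4 A w \<le> 0"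
    using esym_24_le[OF assms(1,2)] assms(4) by (simp add: mult.assoc)
  moreover have "0 < 4 * (real (card A) - 2) * esym 2 A w" using assms by simp
  ultimately show ?thesis by (meson mult_pos_pos not_le)
qed

text \<open>
  On \<open>\<sigma>\<^sub>2 \<le> 0\<close> Newton's constant improves by the factor \<open>3/4\<close>.
\<close>
lemma esym_13_le:
  fixes w :: "real ^ 'e::finite"
  assumes "3 \<le> card A" and "esym 2 A w \<le> 0"
  shows "2 * (real (card A) - 1) * (esym 1 A w * esym 3 A w) \<le> (real (card A) - 2) * (esym 2 A w)\<^sup>2"
proof -
  define n where "n = real (card A)"
  have n: "n \<ge> 3" using assms by (simp add: n_def)
  obtain a b c where e: "esym 1 A w = n * ((a + b + c) / 3)"
    "esym 2 A w = n * (n - 1) / 2 * ((a * b + a * c + b * c) / 3)"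
    "esym 3 A w = n * (n - 1) * (n - 2) / 6 * (a * b * c)"
    using esym_three[OF refl assms(1), of w] unfolding n_def by metis
  have "a * b + a * c + b * c \<le> 0"
    using assms(2) n unfolding e by (simp add: mult_le_0_iff)
  define M where "M = n\<^sup>2 * (n - 1)\<^sup>2 * (n - 2) / 3"
  define q1 q2 q3 where "q1 = (a + b + c) / 3" "q2 = (a * b + a * c + b * c) / 3" "q3 = a * b * c"
  have "M \<ge> 0" using n by (simp add: M_def)
  with \<open>a * b + a * c + b * c \<le> 0\<close> have "M * (q1 * q3) \<le> M * (3 / 4 * q2\<^sup>2)"
    unfolding q1_q2_q3_def by (intro mult_left_mono newton_three_improved)
  moreover have "2 * (n - 1) * (esym 1 A w * esym 3 A w) = M * (q1 * q3)"
    unfolding e[folded q1_q2_q3_def] M_def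
    by (simp add: power2_eq_square, (simp add: algebra_simps)?)
  moreover have "(n - 2) * (esym 2 A w)\<^sup>2 = M * (3 / 4 * q2\<^sup>2)"
    unfolding e[folded q1_q2_q3_def] M_def
    by (simp add: power2_eq_square, (simp add: algebra_simps)?)
  ultimately show ?thesis unfolding n_def by simp
qed

section \<open>The polynomials on the zero sets of the barriers\<close>

text \<open>
  Solve \<open>D = 0\<close> for \<open>X\<^sub>1\<close>, bound \<open>X\<^sub>2\<close> by its maximum for given \<open>X\<^sub>1\<close> and \<open>Y\<^sub>2 Y\<^sub>4\<close> by Newton's
  inequality.  The bound on \<open>mn\<close> is what makes the resulting multiple of \<open>Y\<^sub>3\<^sup>2\<close> nonpositive; it
  reads \<open>3(n-3)(m-1) \<le> 2m(n-2)\<close>.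
\<close>
lemma bip_02_boundary:
  fixes w :: "real ^ 'e::finite"
  assumes m: "card A = m" "4 \<le> m" and n: "card B = n" "4 \<le> n"
    and mn: "real m * real n \<le> 5 * real m + 3 * real n - 9"
    and pos: "0 < esym 1 B w" "0 < esym 2 B w"
    and D: "real m * esym 3 B w + (real m - 1) * (esym 1 A w * esym 2 B w) = 0"
  shows "esym 4 B w + esym 1 A w * esym 3 B w + esym 2 A w * esym 2 B w \<le> 0"
proof -
  define M N where "M = real m" "N = real n"
  define s where "s = esym 1 A w"
  define y2 y3 y4 where "y2 = esym 2 B w" "y3 = esym 3 B w" "y4 = esym 4 B w"
  have MN: "M \<ge> 4" "N \<ge> 4" using m n by (simp_all add: M_N_def)
  have y2: "y2 > 0" using pos by (simp add: y2_y3_y4_def)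
  have x2: "2 * M * esym 2 A w \<le> (M - 1) * s\<^sup>2"
    using esym_2_le[of A w] m by (simp add: M_N_def s_def)
  have newton: "4 * (N - 2) * (y2 * y4) \<le> 3 * (N - 3) * y3\<^sup>2"
    using esym_24_le[of B w] n pos by (simp add: M_N_def y2_y3_y4_def)
  have c: "3 * (N - 3) * (M - 1) \<le> 2 * M * (N - 2)"
    using mn by (simp add: M_N_def algebra_simps)
  have D': "(M - 1) * (s * y2) = - (M * y3)"
    using D by (simp add: M_N_def s_def y2_y3_y4_def)
  have "4 * (N - 2) * (M - 1) * (y2 * y4) \<le> 3 * (N - 3) * (M - 1) * y3\<^sup>2"
    using mult_left_mono[OF newton, of "M - 1"] MN by (simp add: mult.assoc mult.left_commute)
  also have "\<dots> \<le> 2 * M * (N - 2) * y3\<^sup>2" by (intro mult_right_mono c) auto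
  finally have "(2 * (N - 2)) * (2 * (M - 1) * (y2 * y4)) \<le> (2 * (N - 2)) * (M * y3\<^sup>2)"
    by (simp add: algebra_simps)
  moreover have "0 < 2 * (N - 2)" using MN by simp
  ultimately have y4: "2 * (M - 1) * (y2 * y4) \<le> M * y3\<^sup>2"
    by (rule mult_left_le_imp_le)
  have "2 * M * (M - 1) * (y2 * (y4 + s * y3 + esym 2 A w * y2)) =
     M * (2 * (M - 1) * (y2 * y4)) + 2 * M * ((M - 1) * (s * y2)) * y3 + (M - 1) * y2\<^sup>2 * (2 * M * esym 2 A w)"
    by (simp add: power2_eq_square algebra_simps)
  also have "\<dots> \<le> M * (M * y3\<^sup>2) + 2 * M * ((M - 1) * (s * y2)) * y3 + (M - 1) * y2\<^sup>2 * ((M - 1) * s\<^sup>2)"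
    using MN by (intro add_mono[OF add_mono[OF mult_left_mono[OF y4] order_refl] mult_left_mono[OF x2]]) auto
  also have "(M - 1) * y2\<^sup>2 * ((M - 1) * s\<^sup>2) = ((M - 1) * (s * y2))\<^sup>2"
    by (simp add: power2_eq_square)
  also have "M * (M * y3\<^sup>2) + 2 * M * ((M - 1) * (s * y2)) * y3 + ((M - 1) * (s * y2))\<^sup>2 = 0"
    unfolding D' by (simp add: power2_eq_square)
  finally have "(2 * M * (M - 1) * y2) * (y4 + s * y3 + esym 2 A w * y2) \<le> 0"
    by (simp add: mult.assoc)
  moreover have "2 * M * (M - 1) * y2 > 0" using MN y2 by simp
  ultimately have "y4 + s * y3 + esym 2 A w * y2 \<le> 0" by (meson mult_pos_pos not_le)
  then show ?thesis by (simp add: s_def y2_y3_y4_def)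
qed

text \<open>
  The barrier \<open>S\<close> cannot reach \<open>0\<close> while \<open>D > 0\<close>: on \<open>S = 0\<close>, after eliminating \<open>X\<^sub>1\<close>, the bound for
  \<open>X\<^sub>2\<close> in terms of \<open>X\<^sub>1\<^sup>2\<close> and Newton's bound for \<open>Y\<^sub>1 Y\<^sub>3\<close> leave a multiple of \<open>Y\<^sub>2\<^sup>2\<close> in which the
  bound on \<open>mn\<close>, in the form \<open>4(m-2)(n-2) \<le> 3(m-1)(n-1)\<close>, gives the sign.
\<close>
lemma bip_13_side:
  fixes w :: "real ^ 'e::finite"
  assumes m: "card A = m" "4 \<le> m" and n: "card B = n" "4 \<le> n"
    and mn: "real m * real n \<le> 5 * real m + 5 * real n - 13"
    and pos: "0 < esym 1 B w"
    and S: "real m * esym 2 B w + (real m - 2) * (esym 1 A w * esym 1 B w) = 0"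
  shows "real m * esym 3 B w + (real m - 1) * (esym 1 A w * esym 2 B w) +
      (real m - 2) * (esym 2 A w * esym 1 B w) \<le> 0"
proof -
  define M N where "M = real m" "N = real n"
  define x1 x2 where "x1 = esym 1 A w" "x2 = esym 2 A w"
  define y1 y2 y3 where "y1 = esym 1 B w" "y2 = esym 2 B w" "y3 = esym 3 B w"
  note defs = M_N_def x1_x2_def y1_y2_y3_def
  have MN: "M \<ge> 4" "N \<ge> 4" using m n by (simp_all add: M_N_def)
  have y1: "y1 > 0" using pos by (simp add: defs)
  have x2: "2 * M * x2 \<le> (M - 1) * x1\<^sup>2"
    using esym_2_le[of A w] m by (simp add: defs)
  have newton: "3 * (N - 1) * (y1 * y3) \<le> 2 * (N - 2) * y2\<^sup>2"
    using esym_13_newton[of B w] n by (simp add: defs)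
  have c: "4 * (M - 2) * (N - 2) \<le> 3 * (M - 1) * (N - 1)"
    using mn by (simp add: M_N_def algebra_simps)
  have S': "(M - 2) * (x1 * y1) = - (M * y2)"
    using S by (simp add: defs)
  have "(3 * (N - 1)) * (2 * (M - 2) * (y1 * y3)) = 2 * (M - 2) * (3 * (N - 1) * (y1 * y3))" by simp
  also have "\<dots> \<le> 2 * (M - 2) * (2 * (N - 2) * y2\<^sup>2)" using newton MN by (intro mult_left_mono) auto
  also have "\<dots> = 4 * (M - 2) * (N - 2) * y2\<^sup>2" by (simp add: algebra_simps)
  also have "\<dots> \<le> 3 * (M - 1) * (N - 1) * y2\<^sup>2" by (intro mult_right_mono c) auto
  also have "\<dots> = (3 * (N - 1)) * ((M - 1) * y2\<^sup>2)" by (simp add: algebra_simps)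
  finally have "(3 * (N - 1)) * (2 * (M - 2) * (y1 * y3)) \<le> (3 * (N - 1)) * ((M - 1) * y2\<^sup>2)" .
  moreover have "0 < 3 * (N - 1)" using MN by simp
  ultimately have y13: "2 * (M - 2) * (y1 * y3) \<le> (M - 1) * y2\<^sup>2" by (rule mult_left_le_imp_le)
  have "2 * M * (M - 2) * y1 * (M * y3 + (M - 1) * (x1 * y2) + (M - 2) * (x2 * y1)) =
      M\<^sup>2 * (2 * (M - 2) * (y1 * y3)) + 2 * M * (M - 1) * ((M - 2) * (x1 * y1)) * y2 +
      ((M - 2) * y1)\<^sup>2 * (2 * M * x2)"
    by (simp add: power2_eq_square algebra_simps)
  also have "\<dots> \<le> M\<^sup>2 * ((M - 1) * y2\<^sup>2) + 2 * M * (M - 1) * ((M - 2) * (x1 * y1)) * y2 +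
      ((M - 2) * y1)\<^sup>2 * ((M - 1) * x1\<^sup>2)"
    by (intro add_mono[OF add_mono[OF mult_left_mono[OF y13] order_refl] mult_left_mono[OF x2]]) auto
  also have "((M - 2) * y1)\<^sup>2 * ((M - 1) * x1\<^sup>2) = (M - 1) * ((M - 2) * (x1 * y1))\<^sup>2"
    by (simp add: power2_eq_square)
  also have "M\<^sup>2 * ((M - 1) * y2\<^sup>2) + 2 * M * (M - 1) * ((M - 2) * (x1 * y1)) * y2 +
      (M - 1) * ((M - 2) * (x1 * y1))\<^sup>2 = 0"
    unfolding S' by (simp add: power2_eq_square algebra_simps)
  finally have "2 * M * (M - 2) * y1 * (M * y3 + (M - 1) * (x1 * y2) + (M - 2) * (x2 * y1)) \<le> 0" .
  moreover have "0 < 2 * M * (M - 2) * y1" using MN y1 by simp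
  ultimately have "M * y3 + (M - 1) * (x1 * y2) + (M - 2) * (x2 * y1) \<le> 0"
    by (meson mult_pos_pos not_le)
  then show ?thesis by (simp add: defs)
qed

text \<open>
  Let \<open>q\<^sub>k\<close> be the symmetric means of \<open>x\<close>, and write those of \<open>y\<close> as \<open>p, pb, pg, ph\<close>.  With
  \<open>l = (n-1)/(2(m-2))\<close>, \<open>\<theta> = 4(m-2)(n-2)/(3(m-1)(n-1))\<close>, the translation length is \<open>a = lb\<close>, and
  \<open>S \<ge> 0\<close>, \<open>D = 0\<close> become \<open>q\<^sub>1 + a \<ge> 0\<close> and \<open>q\<^sub>2 + 2aq\<^sub>1 + a\<^sup>2 = (lu)\<^sup>2\<close> with \<open>u\<^sup>2 = b\<^sup>2 - \<theta>g\<close>.  The bound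
  on \<open>mn\<close> says \<open>\<theta> \<le> 1\<close>; together with \<open>g \<le> b\<^sup>2\<close> it makes \<open>u\<close> real, and with the improved bound for
  \<open>b \<le> 0\<close> it makes \<open>2u + b\<close> nonnegative.  Then \<open>shifted_cubic_le\<close> gives the first claim.  For the
  second one \<open>h \<le> (d-b)\<^sup>2 (2d+b)\<close> with \<open>d\<^sup>2 = b\<^sup>2 - g\<close> is compared with the negative term by
  \<open>cubic_comparison\<close>; this leaves the estimate \<open>E \<le> C (l\<theta>)\<^sup>3\<close> between coefficients, which holds for
  all \<open>m, n \<ge> 4\<close>.
\<close>
lemma bip_13_boundary:
  fixes w :: "real ^ 'e::finite"
  assumes m: "card A = m" "4 \<le> m" and n: "card B = n" "4 \<le> n"
    and mn: "real m * real n \<le> 5 * real m + 5 * real n - 13"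
    and pos: "0 < esym 1 B w"
    and S: "0 \<le> real m * esym 2 B w + (real m - 2) * (esym 1 A w * esym 1 B w)"
    and D: "real m * esym 3 B w + (real m - 1) * (esym 1 A w * esym 2 B w) +
      (real m - 2) * (esym 2 A w * esym 1 B w) = 0"
  shows "esym 1 A w * esym 3 B w + esym 2 A w * esym 2 B w + esym 3 A w * esym 1 B w \<le> 0" (is "?f \<le> 0")
    and "esym 4 B w + (esym 1 A w * esym 3 B w + esym 2 A w * esym 2 B w + esym 3 A w * esym 1 B w) \<le> 0"
proof -
  define M N where "M = real m" "N = real n"
  have MN: "M \<ge> 4" "N \<ge> 4" using m n by (simp_all add: M_N_def)
  have m3: "m \<ge> 3" and nz: "esym 1 B w \<noteq> 0" using m pos by simp_all
  obtain x y v where X: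
    "esym 1 A w = M * ((x + y + v) / 3)"
    "esym 2 A w = M * (M - 1) / 2 * ((x * y + x * v + y * v) / 3)"
    "esym 3 A w = M * (M - 1) * (M - 2) / 6 * (x * y * v)"
    using esym_three[OF m(1) m3] unfolding M_N_def by metis
  obtain r s t p where Y:
    "esym 1 B w = N * p"
    "esym 2 B w = N * (N - 1) / 2 * (p * ((r + s + t) / 3))"
    "esym 3 B w = N * (N - 1) * (N - 2) / 6 * (p * ((r * s + r * t + s * t) / 3))"
    "esym 4 B w = N * (N - 1) * (N - 2) * (N - 3) / 24 * (p * (r * s * t))"
    using esym_four[OF n nz] unfolding M_N_def by metis
  define q1 q2 q3 where "q1 = (x + y + v) / 3" "q2 = (x * y + x * v + y * v) / 3" "q3 = x * y * v"
  define b g h where "b = (r + s + t) / 3" "g = (r * s + r * t + s * t) / 3" "h = r * s * t"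
  note X = X[folded q1_q2_q3_def] and Y = Y[folded b_g_h_def]
  have p: "p > 0" using pos MN unfolding Y by (simp add: zero_less_mult_iff)
  define l where "l = (N - 1) / 2 / (M - 2)"
  define \<theta> where "\<theta> = 4 * (M - 2) * (N - 2) / (3 * (M - 1) * (N - 1))"
  have l: "l > 0" using MN by (simp add: l_def)
  have th0: "0 < \<theta>" using MN by (simp add: \<theta>_def)
  have "4 * (M - 2) * (N - 2) \<le> 3 * (M - 1) * (N - 1)"
    using mn by (simp add: M_N_def algebra_simps)
  then have th1: "\<theta> \<le> 1" using MN by (simp add: \<theta>_def)
  have lM: "(M - 2) * l = (N - 1) / 2"
  proof -
    have "M - 2 \<noteq> 0" using MN by simp
    then have "l * (M - 2) = (N - 1) / 2" using l_def by (rule iffD1[OF nonzero_eq_divide_eq])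
    then show ?thesis by (simp only: mult.commute)
  qed
  have thMN: "\<theta> * (3 * (M - 1) * (N - 1)) = 4 * (M - 2) * (N - 2)"
  proof -
    have "3 * (M - 1) * (N - 1) \<noteq> 0" using MN by simp
    then show ?thesis using \<theta>_def by (rule iffD1[OF nonzero_eq_divide_eq])
  qed
  have lth: "3 * (M - 1) * (l * \<theta>) = 2 * (N - 2)"
  proof -
    have "(N - 1) * (3 * (M - 1) * (l * \<theta>)) = l * (\<theta> * (3 * (M - 1) * (N - 1)))" by simp
    also have "\<dots> = 4 * ((M - 2) * l) * (N - 2)" unfolding thMN by simp
    also have "\<dots> = (N - 1) * (2 * (N - 2))" unfolding lM by (simp add: field_simps)
    finally show ?thesis using MN by simp
  qed
  define \<kappa> where "\<kappa> = l\<^sup>2 * \<theta>"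
  have kM: "(M - 1) * (M - 2) * \<kappa> = (N - 1) * (N - 2) / 3"
  proof -
    have "(M - 1) * (M - 2) * \<kappa> = ((M - 2) * l) * (3 * (M - 1) * (l * \<theta>)) / 3"
      by (simp add: \<kappa>_def power2_eq_square)
    then show ?thesis unfolding lM lth by (simp add: field_simps)
  qed
  have gb: "g \<le> b\<^sup>2" unfolding b_g_h_def by (rule newton_three_12)
  have gb': "g \<le> 3 / 4 * b\<^sup>2" if "b \<le> 0"
  proof -
    have "esym 2 B w \<le> 0" using that MN p unfolding Y by (intro mult_nonneg_nonpos) auto
    then have "2 * (N - 1) * (esym 1 B w * esym 3 B w) \<le> (N - 2) * (esym 2 B w)\<^sup>2"
      using esym_13_le[of B w] n by (simp add: M_N_def)
    moreover have "2 * (N - 1) * (esym 1 B w * esym 3 B w) = N\<^sup>2 * (N - 1)\<^sup>2 * (N - 2) * p\<^sup>2 / 3 * g"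
      unfolding Y by (simp add: power2_eq_square, (simp add: algebra_simps)?)
    moreover have "(N - 2) * (esym 2 B w)\<^sup>2 = N\<^sup>2 * (N - 1)\<^sup>2 * (N - 2) * p\<^sup>2 / 3 * (3 / 4 * b\<^sup>2)"
      unfolding Y by (simp add: power2_eq_square, (simp add: algebra_simps)?)
    moreover have "0 < N\<^sup>2 * (N - 1)\<^sup>2 * (N - 2) * p\<^sup>2 / 3" using MN p by simp
    ultimately show ?thesis by (metis mult_left_le_imp_le)
  qed
  define d where "d = sqrt (b\<^sup>2 - g)"
  have d: "0 \<le> d" "d\<^sup>2 = b\<^sup>2 - g" using gb by (simp_all add: d_def)
  have thg: "\<theta> * g \<le> max 0 g"
    using th0 th1 by (cases "g \<le> 0") (auto simp: mult_nonneg_nonpos mult_left_le_one_le max_def)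
  define u where "u = sqrt (b\<^sup>2 - \<theta> * g)"
  have "\<theta> * g \<le> b\<^sup>2" using thg gb by (auto simp: max_def split: if_splits intro: order_trans)
  then have u: "0 \<le> u" "u\<^sup>2 = b\<^sup>2 - \<theta> * g" by (simp_all add: u_def)
  have half: "- b \<le> 2 * e" if e: "0 \<le> e" "b\<^sup>2 - max 0 g \<le> e\<^sup>2" for e
  proof (cases "b \<le> 0")
    case True
    have "max 0 g \<le> 3 / 4 * b\<^sup>2" using gb'[OF True] by (intro max.boundedI) auto
    then have "b\<^sup>2 \<le> 4 * e\<^sup>2" using e(2) by linarith
    then have "(- b)\<^sup>2 \<le> (2 * e)\<^sup>2" by (simp add: power_mult_distrib)
    then show ?thesis by (rule power2_le_imp_le) (use e in simp)
  qed (use e in auto)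
  have db: "- b \<le> 2 * d" and ub: "- b \<le> 2 * u"
    using half[of d] half[of u] d u thg by auto
  have K: "0 < M * N * p" using MN p by simp
  have a1: "0 \<le> q1 + l * b"
  proof -
    have "M * esym 2 B w + (M - 2) * (esym 1 A w * esym 1 B w) = (M * N * p * (M - 2)) * (q1 + l * b)"
    proof -
      have "(M * N * p * (M - 2)) * (q1 + l * b) = M * N * p * ((M - 2) * q1 + ((M - 2) * l) * b)"
        by (simp add: algebra_simps)
      then show ?thesis unfolding X Y lM by (simp add: field_simps)
    qed
    moreover have "0 < M * N * p * (M - 2)" using K MN by simp
    ultimately show ?thesis using S unfolding M_N_def[symmetric] by (simp add: zero_le_mult_iff)
  qed
  have a2: "q2 + 2 * (l * b) * q1 + (l * b)\<^sup>2 = (l * u)\<^sup>2"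
  proof -
    have *: "M * esym 3 B w + (M - 1) * (esym 1 A w * esym 2 B w) + (M - 2) * (esym 2 A w * esym 1 B w) =
        (M * N * p * ((M - 1) * (M - 2) / 2)) * (q2 + 2 * (l * b) * q1 + \<kappa> * g)" (is "_ = ?r")
    proof -
      have "(M * N * p * ((M - 1) * (M - 2) / 2)) * (q2 + 2 * (l * b) * q1 + \<kappa> * g) =
        M * N * p * ((M - 1) * (M - 2) / 2 * q2 + (M - 1) * ((M - 2) * l) * b * q1 +
          ((M - 1) * (M - 2) * \<kappa>) / 2 * g)"
        by (simp add: field_simps)
      then show ?thesis unfolding X Y lM kM by (simp add: field_simps)
    qed
    have "q2 + 2 * (l * b) * q1 + \<kappa> * g = 0"
    proof -
      have "?r = 0" using trans[OF sym[OF *] D[folded M_N_def]] .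
      moreover have "M * N * p * ((M - 1) * (M - 2) / 2) > 0" using p MN by (intro mult_pos_pos) auto
      ultimately show ?thesis by (metis less_irrefl mult_eq_0_iff)
    qed
    then show ?thesis unfolding power_mult_distrib u(2) \<kappa>_def by (simp add: algebra_simps)
  qed
  define G where "G = (u - b)\<^sup>2 * (2 * u + b)"
  have G: "0 \<le> G" unfolding G_def using ub by simp
  define C where "C = N * p * (M * (M - 1) * (M - 2) / 6)"
  have C: "0 < C" using MN p by (simp add: C_def)
  have fC: "?f = C * (q3 + 3 * (l * b) * q2 + 3 * ((l * b)\<^sup>2 - (l * u)\<^sup>2) * q1)"
  proof -
    have *: "(l * b)\<^sup>2 - (l * u)\<^sup>2 = \<kappa> * g"
      unfolding power_mult_distrib u(2) \<kappa>_def by (simp add: algebra_simps)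
    have "C * (q3 + 3 * (l * b) * q2 + 3 * (\<kappa> * g) * q1) =
      N * p * M * ((M - 1) * (M - 2) / 6 * q3 + (M - 1) * ((M - 2) * l) / 2 * b * q2 +
        ((M - 1) * (M - 2) * \<kappa>) / 2 * g * q1)"
      unfolding C_def by (simp add: field_simps)
    then show ?thesis unfolding * X Y lM kM by (simp add: field_simps)
  qed
  have "q3 + 3 * (l * b) * q2 + 3 * ((l * b)\<^sup>2 - (l * u)\<^sup>2) * q1 \<le> - ((l * u - l * b)\<^sup>2 * (2 * (l * u) + l * b))"
    using shifted_cubic_le[of "l * u" x y v "l * b"] l u(1) a1 a2
    unfolding q1_q2_q3_def by simp
  also have "\<dots> = - (l ^ 3 * G)"
    by (simp add: G_def power2_eq_square power3_eq_cube algebra_simps)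
  finally have f_le: "?f \<le> - (C * l ^ 3 * G)"
    unfolding fC using C mult_left_mono[of _ "- (l ^ 3 * G)" C] by (simp add: mult.assoc)
  have "0 \<le> C * l ^ 3 * G" using C l G by simp
  with f_le show "?f \<le> 0" by linarith
  have "h \<le> (d - b)\<^sup>2 * (2 * d + b)"
    using three_product_le[of d r s t] d unfolding b_g_h_def by simp
  then have "\<theta> ^ 3 * h \<le> \<theta> ^ 3 * ((d - b)\<^sup>2 * (2 * d + b))" using th0 by simp
  also have "\<dots> \<le> G"
    unfolding G_def
  proof (rule cubic_comparison[OF th0 th1 d(1) u(1) _ db])
    show "u\<^sup>2 - b\<^sup>2 = \<theta> * (d\<^sup>2 - b\<^sup>2)" unfolding d(2) u(2) by simp
  qed
  finally have hG: "\<theta> ^ 3 * h \<le> G" .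
  define E where "E = N * p * ((N - 1) * (N - 2) * (N - 3) / 24)"
  have E: "0 < E" using MN p by (simp add: E_def)
  have "E \<le> C * (l * \<theta>) ^ 3"
  proof -
    have n1: "(N - 1) * (N - 3) \<le> (N - 2)\<^sup>2"
      by (simp add: power2_eq_square algebra_simps)
    have m1: "27 * (M - 1)\<^sup>2 \<le> 32 * (M * (M - 2))"
    proof -
      have "0 \<le> (M - 4) * (5 * M + 10) + 13" using MN by (intro add_nonneg_nonneg) auto
      then show ?thesis by (simp add: power2_eq_square algebra_simps)
    qed
    have "(N - 1) * (N - 3) * (27 * (M - 1)\<^sup>2) \<le> (N - 2)\<^sup>2 * (32 * (M * (M - 2)))"
      by (intro mult_mono n1 m1) (use MN in auto)
    then have "N * p * (N - 2) / (24 * 27 * (M - 1)\<^sup>2) * ((N - 1) * (N - 3) * (27 * (M - 1)\<^sup>2)) \<le>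
        N * p * (N - 2) / (24 * 27 * (M - 1)\<^sup>2) * ((N - 2)\<^sup>2 * (32 * (M * (M - 2))))"
      using MN p by (intro mult_left_mono) auto
    moreover have "N * p * (N - 2) / (24 * 27 * (M - 1)\<^sup>2) * ((N - 1) * (N - 3) * (27 * (M - 1)\<^sup>2)) = E"
      using MN by (simp add: E_def)
    moreover have "N * p * (N - 2) / (24 * 27 * (M - 1)\<^sup>2) * ((N - 2)\<^sup>2 * (32 * (M * (M - 2)))) = C * (l * \<theta>) ^ 3"
    proof -
      have lt: "l * \<theta> = 2 * (N - 2) / (3 * (M - 1))" using lth MN by (simp add: eq_divide_eq mult.commute)
      have gen: "N * p * Q / (24 * 27 * R\<^sup>2) * (Q\<^sup>2 * (32 * (M * (M - 2)))) =
          N * p * (M * R * (M - 2) / 6) * (2 * Q / (3 * R)) ^ 3" if "R \<noteq> 0" for Q R :: real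
        using that by (simp add: power2_eq_square power3_eq_cube)
      show ?thesis unfolding C_def lt by (rule gen) (use MN in simp)
    qed
    ultimately show ?thesis by simp
  qed
  have "\<theta> ^ 3 * (E * h) = E * (\<theta> ^ 3 * h)" by simp
  also have "\<dots> \<le> E * G" using E hG by simp
  also have "\<dots> \<le> C * (l * \<theta>) ^ 3 * G" by (rule mult_right_mono) fact+
  also have "\<dots> = \<theta> ^ 3 * (C * l ^ 3 * G)" by (simp add: power_mult_distrib)
  finally have "E * h \<le> C * l ^ 3 * G" using th0 by simp
  moreover have "esym 4 B w = E * h" unfolding Y E_def by simp
  ultimately show "esym 4 B w + ?f \<le> 0" using f_le by linarith
qed

section \<open>The bipartite rank four matroid\<close>

lemma esym_product_eq_basis_sum:
  fixes w :: "real ^ 'e::finite"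
  assumes AB: "A \<inter> B = {}" "A \<union> B = UNIV" and "i \<le> 4"
  shows "esym i A w * esym (4 - i) B w = (\<Sum>T | card T = 4 \<and> card (T \<inter> A) = i. \<Prod>e\<in>T. w $ e)"
proof -
  have card_split: "card T = card (T \<inter> A) + card (T \<inter> B)" for T :: "'e set"
  proof -
    have "T = (T \<inter> A) \<union> (T \<inter> B)" using AB by blast
    moreover have "(T \<inter> A) \<inter> (T \<inter> B) = {}" using AB by blast
    ultimately show ?thesis by (metis card_Un_disjoint finite)
  qed
  have "esym i A w * esym (4 - i) B w =
    (\<Sum>(P, Q)\<in>{S. S \<subseteq> A \<and> card S = i} \<times> {S. S \<subseteq> B \<and> card S = 4 - i}. (\<Prod>e\<in>P. w $ e) * (\<Prod>e\<in>Q. w $ e))"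
    unfolding esym_def sum_product sum.cartesian_product ..
  also have "\<dots> = (\<Sum>T | card T = 4 \<and> card (T \<inter> A) = i. \<Prod>e\<in>T. w $ e)"
  proof (rule sum.reindex_bij_witness[of _ "\<lambda>T. (T \<inter> A, T \<inter> B)" "\<lambda>(P, Q). P \<union> Q"])
    fix T assume "T \<in> {T. card T = 4 \<and> card (T \<inter> A) = i}"
    then show "(T \<inter> A, T \<inter> B) \<in> {S. S \<subseteq> A \<and> card S = i} \<times> {S. S \<subseteq> B \<and> card S = 4 - i}"
      using card_split[of T] by auto
    show "(\<lambda>(P, Q). P \<union> Q) (T \<inter> A, T \<inter> B) = T" using AB by auto
  next
    fix PQ assume "PQ \<in> {S. S \<subseteq> A \<and> card S = i} \<times> {S. S \<subseteq> B \<and> card S = 4 - i}"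
    then obtain P Q where PQ: "PQ = (P, Q)" "P \<subseteq> A" "card P = i" "Q \<subseteq> B" "card Q = 4 - i" by auto
    then have inter: "(P \<union> Q) \<inter> A = P" "(P \<union> Q) \<inter> B = Q" "P \<inter> Q = {}" using AB by auto
    then show "(\<lambda>T. (T \<inter> A, T \<inter> B)) ((\<lambda>(P, Q). P \<union> Q) PQ) = PQ" by (simp add: PQ)
    show "(\<lambda>(P, Q). P \<union> Q) PQ \<in> {T. card T = 4 \<and> card (T \<inter> A) = i}"
      using inter card_split[of "P \<union> Q"] PQ assms(3) by simp
    show "(\<Prod>e\<in>(\<lambda>(P, Q). P \<union> Q) PQ. w $ e) = (case PQ of (P, Q) \<Rightarrow> (\<Prod>e\<in>P. w $ e) * (\<Prod>e\<in>Q. w $ e))"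
      unfolding PQ(1) prod.case by (rule prod.union_disjoint) (use inter in auto)
  qed
  finally show ?thesis .
qed

definition bip_bases :: "nat \<Rightarrow> nat \<Rightarrow> 'e set \<Rightarrow> 'e::finite set set" where
  "bip_bases l u A = {T. card T = 4 \<and> l \<le> card (T \<inter> A) \<and> card (T \<inter> A) \<le> u}"

lemma bip_poly_eq_basis_genfun:
  fixes A B :: "'e::finite set"
  assumes AB: "A \<inter> B = {}" "A \<union> B = UNIV" and "u \<le> 4"
  shows "bip_poly l u A B = basis_genfun (bip_bases l u A)"
proof
  fix w :: "real ^ 'e"
  have "bip_poly l u A B w =
      (\<Sum>i = l..u. \<Sum>T | card T = 4 \<and> card (T \<inter> A) = i. \<Prod>e\<in>T. w $ e)"
    unfolding bip_poly_def
    by (intro sum.cong refl esym_product_eq_basis_sum[OF AB]) (use \<open>u \<le> 4\<close> in auto)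
  also have "\<dots> = (\<Sum>T\<in>(\<Union>i\<in>{l..u}. {T. card T = 4 \<and> card (T \<inter> A) = i}). \<Prod>e\<in>T. w $ e)"
    by (rule sum.UNION_disjoint[symmetric]) auto
  also have "(\<Union>i\<in>{l..u}. {T. card T = 4 \<and> card (T \<inter> A) = i}) = bip_bases l u A"
    by (auto simp: bip_bases_def)
  finally show "bip_poly l u A B w = basis_genfun (bip_bases l u A) w"
    by (simp add: basis_genfun_def)
qed

lemma multi_affine_basis_genfun: "multi_affine (basis_genfun \<B>)"
proof -
  have "basis_genfun \<B> w = (\<Sum>S\<in>UNIV. (if S \<in> \<B> then 1 else 0) * (\<Prod>e\<in>S. w $ e))" for w :: "real ^ 'a"
  proof -
    have "(\<Sum>S\<in>UNIV. (if S \<in> \<B> then 1 else 0) * (\<Prod>e\<in>S. w $ e)) =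
        (\<Sum>S\<in>UNIV. if S \<in> \<B> then \<Prod>e\<in>S. w $ e else 0)"
      by (intro sum.cong) auto
    then show ?thesis unfolding basis_genfun_def by (simp add: sum.If_cases)
  qed
  then show ?thesis unfolding multi_affine_def
    by (intro exI[of _ "\<lambda>S. if S \<in> \<B> then 1 else 0"] allI)
qed

lemma bip_poly_swap:
  assumes "l \<le> u" "u \<le> 4"
  shows "bip_poly l u A B w = bip_poly (4 - u) (4 - l) B A w"
  unfolding bip_poly_def
  by (rule sum.reindex_bij_witness[of _ "\<lambda>i. 4 - i" "\<lambda>i. 4 - i"]) (use assms in auto)

lemma bip_poly_full:
  fixes A B :: "'e::finite set"
  assumes AB: "A \<inter> B = {}" "A \<union> B = UNIV"
  shows "bip_poly 0 4 A B = esym 4 UNIV"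
proof
  fix w :: "real ^ 'e"
  have "card (T \<inter> A) \<le> 4" if "card T = 4" for T :: "'e set"
    using card_mono[of T "T \<inter> A"] that by simp
  then have "bip_bases 0 4 A = {T. T \<subseteq> UNIV \<and> card T = 4}"
    by (auto simp: bip_bases_def)
  then show "bip_poly 0 4 A B w = esym 4 UNIV w"
    unfolding bip_poly_eq_basis_genfun[OF AB order_refl] basis_genfun_def esym_def by simp
qed

text \<open>
  Exchange \<open>a\<close> for an element of the same side if \<open>T - S\<close> has one.  Otherwise \<open>T\<close> has fewer elements
  than \<open>S\<close> on the side of \<open>a\<close>, so moving one element of \<open>S\<close> to the other side respects the bounds.
\<close>
lemma bip_bases_exchange:
  fixes A B :: "'e::finite set"
  assumes AB: "A \<inter> B = {}" "A \<union> B = UNIV" and S: "S \<in> bip_bases l u A" and T: "T \<in> bip_bases l u A"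
    and a: "a \<in> S - T"
  shows "\<exists>b\<in>T - S. insert b (S - {a}) \<in> bip_bases l u A"
proof -
  have cS: "card S = 4" "l \<le> card (S \<inter> A)" "card (S \<inter> A) \<le> u"
    and cT: "card T = 4" "l \<le> card (T \<inter> A)" "card (T \<inter> A) \<le> u"
    using S T by (auto simp: bip_bases_def)
  have split: "card X = card (X \<inter> A) + card (X - A)" for X :: "'e set"
    by (metis card_Int_Diff finite)
  have card_new: "card (insert b (S - {a})) = 4" if "b \<in> T - S" for b
    using that a cS(1) by (simp add: card_Diff_singleton)
  have "T - S \<noteq> {}"
  proof
    assume "T - S = {}"
    then have "T \<subset> S" using a by blast
    then show False using psubset_card_mono[of S T] cS(1) cT(1) by simp
  qed
  then obtain b0 where b0: "b0 \<in> T - S" by blast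
  show ?thesis
  proof (cases "\<exists>b\<in>T - S. (b \<in> A \<longleftrightarrow> a \<in> A)")
    case True
    then obtain b where b: "b \<in> T - S" "b \<in> A \<longleftrightarrow> a \<in> A" by blast
    have "card (insert b (S - {a}) \<inter> A) = card (S \<inter> A)"
    proof (cases "a \<in> A")
      case True
      then have "insert b (S - {a}) \<inter> A = insert b (S \<inter> A - {a})" using b by blast
      then have "card (insert b (S - {a}) \<inter> A) = Suc (card (S \<inter> A - {a}))" using b by simp
      also have "\<dots> = card (S \<inter> A)" by (rule card_Suc_Diff1) (use a True in auto)
      finally show ?thesis .
    next
      case False
      then have "insert b (S - {a}) \<inter> A = S \<inter> A" using b by blast
      then show ?thesis by simp
    qed
    then have "insert b (S - {a}) \<in> bip_bases l u A"
      using card_new[OF b(1)] cS by (simp add: bip_bases_def)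
    then show ?thesis using b(1) by blast
  next
    case False
    show ?thesis
    proof (cases "a \<in> A")
      case True
      then have "T \<inter> A \<subset> S \<inter> A" using False a by blast
      then have "card (T \<inter> A) < card (S \<inter> A)" by (intro psubset_card_mono) auto
      moreover have "insert b0 (S - {a}) \<inter> A = S \<inter> A - {a}" using b0 False True by blast
      then have "card (insert b0 (S - {a}) \<inter> A) = card (S \<inter> A) - 1" using True a by (simp add: card_Diff_singleton)
      ultimately have "insert b0 (S - {a}) \<in> bip_bases l u A"
        using card_new[OF b0] cS cT by (auto simp: bip_bases_def)
      then show ?thesis using b0 by blast
    next
      case aB: False
      then have "T - A \<subset> S - A" using False a by blast
      then have "card (T - A) < card (S - A)" by (intro psubset_card_mono) auto
      then have "card (S \<inter> A) < card (T \<inter> A)" using split[of S] split[of T] cS(1) cT(1) by simp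
      moreover have "insert b0 (S - {a}) \<inter> A = insert b0 (S \<inter> A)" using b0 False aB by blast
      then have "card (insert b0 (S - {a}) \<inter> A) = Suc (card (S \<inter> A))" using b0 by simp
      ultimately have "insert b0 (S - {a}) \<in> bip_bases l u A"
        using card_new[OF b0] cS cT by (auto simp: bip_bases_def)
      then show ?thesis using b0 by blast
    qed
  qed
qed

lemma bip_bases_nonempty:
  fixes A B :: "'e::finite set"
  assumes AB: "A \<inter> B = {}" "A \<union> B = UNIV" and "4 \<le> card A" "4 \<le> card B" and "l \<le> u" "u \<le> 4"
  shows "bip_bases l u A \<noteq> {}"
proof -
  have "l \<le> card A" "4 - l \<le> card B" using assms by auto
  then obtain P Q where PQ: "P \<subseteq> A" "card P = l" "Q \<subseteq> B" "card Q = 4 - l"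
    using obtain_subset_with_card_n by metis
  then have "(P \<union> Q) \<inter> A = P" "P \<inter> Q = {}" using AB by auto
  moreover from this have "card (P \<union> Q) = 4" using PQ assms by (simp add: card_Un_disjoint)
  ultimately have "P \<union> Q \<in> bip_bases l u A" using PQ assms by (simp add: bip_bases_def)
  then show ?thesis by blast
qed

lemma matroid_bases_bip:
  fixes A B :: "'e::finite set"
  assumes "A \<inter> B = {}" "A \<union> B = UNIV" and "4 \<le> card A" "4 \<le> card B" and "l \<le> u" "u \<le> 4"
  shows "matroid_bases (bip_bases l u A)"
  unfolding matroid_bases_def
  using bip_bases_nonempty[OF assms] bip_bases_exchange[OF assms(1,2)] by blast

lemma basis_genfun_pos:
  assumes "w \<in> pos_orthant" "\<B> \<noteq> {}"
  shows "0 < basis_genfun \<B> w"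
  unfolding basis_genfun_def using assms
  by (intro sum_pos) (auto simp: pos_orthant_def intro!: prod_pos)

section \<open>Cases with the Garding property\<close>

lemma esym_pos:
  assumes "w \<in> pos_orthant" "k \<le> card A"
  shows "0 < esym k A w"
proof -
  obtain S where "S \<subseteq> A" "card S = k" using obtain_subset_with_card_n[OF assms(2)] by blast
  then show ?thesis unfolding esym_def
    using assms(1) by (intro sum_pos) (auto simp: pos_orthant_def intro!: prod_pos)
qed

lemma continuous_on_esym [continuous_intros]: "continuous_on S (esym k A)"
  unfolding esym_def[abs_def] by (intro continuous_intros)

lemma esym_axis_notin:
  assumes "j \<notin> A"
  shows "esym k A (w + axis j t) = esym k A w"
  unfolding esym_def
  by (intro sum.cong prod.cong refl) (use assms in \<open>auto simp: axis_def\<close>)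

lemma esym_1_axis: "j \<in> A \<Longrightarrow> esym 1 A (w + axis j t) = esym 1 A w + t"
  unfolding esym_1 by (simp add: axis_def sum.distrib)

lemma esym_1_line: "j \<in> A \<Longrightarrow> \<exists>t. \<not> 0 < esym 1 A (w + axis j t)"
  by (rule exI[of _ "- esym 1 A w"]) (simp only: esym_1_axis)

lemma affine_nonpos: "d \<noteq> 0 \<Longrightarrow> \<exists>t. \<not> 0 < c + t * d" for c d :: real
  by (rule exI[of _ "- c / d"]) simp

text \<open>
  The barriers \<open>\<sigma>\<^sub>1, \<sigma>\<^sub>2, \<sigma>\<^sub>3\<close> cut out the hyperbolicity cone; positivity of \<open>\<sigma>\<^sub>1\<close> excludes lines in
  all directions on which \<open>\<sigma>\<^sub>4\<close> depends.
\<close>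
lemma garding_esym_4:
  fixes C :: "'e::finite set"
  assumes C: "4 \<le> card C"
  shows "garding (esym 4 C)"
proof (rule garding_criterion[where G = "{esym 1 C, esym 2 C, esym 3 C}"])
  have "esym 4 C = basis_genfun {T. T \<subseteq> C \<and> card T = 4}"
    by (simp add: fun_eq_iff esym_def basis_genfun_def)
  then show "multi_affine (esym 4 C)" by (simp add: multi_affine_basis_genfun)
next
  fix w g assume f: "0 < esym 4 C w" and nn: "\<And>g. g \<in> {esym 1 C, esym 2 C, esym 3 C} \<Longrightarrow> 0 \<le> g w"
    and g: "g \<in> {esym 1 C, esym 2 C, esym 3 C}"
  have e: "0 \<le> esym 1 C w" "0 \<le> esym 2 C w" "0 \<le> esym 3 C w" using nn by blast+
  have "esym 1 C w \<noteq> 0" using esym_vanish[of C w 4] e(2) f by force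
  then have p1: "0 < esym 1 C w" using e(1) by linarith
  have "esym 2 C w \<noteq> 0" using esym_2_eq_0[OF C p1] e(3) f by force
  then have p2: "0 < esym 2 C w" using e(2) by linarith
  have "esym 3 C w \<noteq> 0" using esym_3_eq_0[OF C p1 p2] f by force
  then show "0 < g w" using g p1 p2 e(3) by auto
next
  fix j
  show "(\<forall>w t. esym 4 C (w + axis j t) = esym 4 C w) \<or>
    (\<forall>w. (\<forall>g\<in>{esym 1 C, esym 2 C, esym 3 C}. 0 < g w) \<longrightarrow>
      (\<exists>t. \<not> (0 < esym 4 C (w + axis j t) \<and> (\<forall>g\<in>{esym 1 C, esym 2 C, esym 3 C}. 0 < g (w + axis j t)))))"
    using esym_1_line[of j C] esym_axis_notin[of j C] by (cases "j \<in> C") auto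
qed (use C in \<open>auto intro: esym_pos continuous_on_esym\<close>)

lemma bip_poly_expand:
  "bip_poly 0 0 A B w = esym 4 B w"
  "bip_poly 0 1 A B w = esym 4 B w + esym 1 A w * esym 3 B w"
  "bip_poly 0 2 A B w = esym 4 B w + esym 1 A w * esym 3 B w + esym 2 A w * esym 2 B w"
  "bip_poly 0 3 A B w = esym 4 B w +
     (esym 1 A w * esym 3 B w + esym 2 A w * esym 2 B w + esym 3 A w * esym 1 B w)"
  "bip_poly 1 1 A B w = esym 1 A w * esym 3 B w"
  "bip_poly 1 2 A B w = esym 1 A w * esym 3 B w + esym 2 A w * esym 2 B w"
  "bip_poly 1 3 A B w = esym 1 A w * esym 3 B w + esym 2 A w * esym 2 B w + esym 3 A w * esym 1 B w"
  "bip_poly 2 2 A B w = esym 2 A w * esym 2 B w"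
proof -
  have ivl: "{0..0::nat} = {0}" "{0..1::nat} = {0, 1}" "{0..2::nat} = {0, 1, 2}" "{0..3::nat} = {0, 1, 2, 3}"
    "{1..1::nat} = {1}" "{1..2::nat} = {1, 2}" "{1..3::nat} = {1, 2, 3}" "{2..2::nat} = {2}"
    by auto
  show "bip_poly 0 0 A B w = esym 4 B w"
    "bip_poly 0 1 A B w = esym 4 B w + esym 1 A w * esym 3 B w"
    "bip_poly 0 2 A B w = esym 4 B w + esym 1 A w * esym 3 B w + esym 2 A w * esym 2 B w"
    "bip_poly 0 3 A B w = esym 4 B w +
       (esym 1 A w * esym 3 B w + esym 2 A w * esym 2 B w + esym 3 A w * esym 1 B w)"
    "bip_poly 1 1 A B w = esym 1 A w * esym 3 B w"
    "bip_poly 1 2 A B w = esym 1 A w * esym 3 B w + esym 2 A w * esym 2 B w"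
    "bip_poly 1 3 A B w = esym 1 A w * esym 3 B w + esym 2 A w * esym 2 B w + esym 3 A w * esym 1 B w"
    "bip_poly 2 2 A B w = esym 2 A w * esym 2 B w"
    unfolding bip_poly_def ivl by simp_all
qed

locale bipartition =
  fixes A B :: "'e::finite set"
  assumes disjoint: "A \<inter> B = {}" and cover: "A \<union> B = UNIV"
    and card_A: "4 \<le> card A" and card_B: "4 \<le> card B"
begin

lemma bip_poly_pos:
  assumes "l \<le> u" "u \<le> 4" "w \<in> pos_orthant"
  shows "0 < bip_poly l u A B w"
  using basis_genfun_pos[OF assms(3) bip_bases_nonempty[OF disjoint cover card_A card_B assms(1,2)]]
  by (simp add: bip_poly_eq_basis_genfun[OF disjoint cover assms(2)])

lemma axis_A:
  assumes "j \<in> A"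
  shows "esym 1 A (w + axis j t) = esym 1 A w + t" and "esym k B (w + axis j t) = esym k B w"
  using assms disjoint by (auto intro: esym_axis_notin esym_1_axis simp del: One_nat_def)

lemma in_A_or_B: "j \<in> A \<or> j \<in> B"
  using cover by auto

text \<open>
  With \<open>Y\<^sub>1\<close> among the barriers only lines in the \<open>x\<close>-directions have to be excluded.
\<close>
lemma garding_bip_criterion:
  assumes lu: "l \<le> u" "u \<le> 4" and G: "finite G"
    "\<And>g. g \<in> G \<Longrightarrow> continuous_on UNIV g"
    "\<And>g w. g \<in> G \<Longrightarrow> w \<in> pos_orthant \<Longrightarrow> 0 < g w"
    and barrier: "\<And>w g. 0 < bip_poly l u A B w \<Longrightarrow> (\<And>g. g \<in> G \<Longrightarrow> 0 \<le> g w) \<Longrightarrow> g \<in> G \<Longrightarrow> 0 < g w"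
    and line_A: "\<And>j w. j \<in> A \<Longrightarrow> \<forall>g\<in>G. 0 < g w \<Longrightarrow>
      \<exists>t. \<not> (0 < bip_poly l u A B (w + axis j t) \<and> (\<forall>g\<in>G. 0 < g (w + axis j t)))"
    and e1B: "esym 1 B \<in> G"
  shows "garding (bip_poly l u A B)"
proof (rule garding_criterion[where G = G])
  show "finite G" by (rule G(1))
  show "continuous_on UNIV g" if "g \<in> G" for g by (rule G(2)[OF that])
  show "0 < g w" if "g \<in> G" "w \<in> pos_orthant" for g w by (rule G(3)[OF that])
  show "0 < g w" if "0 < bip_poly l u A B w" "\<And>g. g \<in> G \<Longrightarrow> 0 \<le> g w" "g \<in> G" for g w
    using that by (intro barrier[of w g]) blast+
  show "multi_affine (bip_poly l u A B)"
    unfolding bip_poly_eq_basis_genfun[OF disjoint cover lu(2)] by (rule multi_affine_basis_genfun)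
  show "0 < bip_poly l u A B w" if "w \<in> pos_orthant" for w
    using bip_poly_pos[OF lu that] .
  fix j
  have "\<exists>t. \<not> (0 < bip_poly l u A B (w + axis j t) \<and> (\<forall>g\<in>G. 0 < g (w + axis j t)))"
    if "\<forall>g\<in>G. 0 < g w" for w
    using in_A_or_B[of j] line_A[OF _ that] esym_1_line[of j B w] e1B by blast
  then show "(\<forall>w t. bip_poly l u A B (w + axis j t) = bip_poly l u A B w) \<or>
    (\<forall>w. (\<forall>g\<in>G. 0 < g w) \<longrightarrow>
      (\<exists>t. \<not> (0 < bip_poly l u A B (w + axis j t) \<and> (\<forall>g\<in>G. 0 < g (w + axis j t)))))"
    by blast
qed

lemma garding_00: "garding (bip_poly 0 0 A B)"
proof -
  have "bip_poly 0 0 A B = esym 4 B" by (simp add: fun_eq_iff bip_poly_expand)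
  then show ?thesis using garding_esym_4[OF card_B] by simp
qed

lemma garding_04: "garding (bip_poly 0 4 A B)"
proof -
  have "4 \<le> card (UNIV :: 'e set)" using card_A card_mono[of UNIV A] by simp
  then show ?thesis unfolding bip_poly_full[OF disjoint cover] by (rule garding_esym_4)
qed

lemma garding_01: "garding (bip_poly 0 1 A B)"
proof (rule garding_bip_criterion[where G = "{esym 1 B, esym 2 B, esym 3 B}"])
  fix w g assume f: "0 < bip_poly 0 1 A B w" and nn: "\<And>g. g \<in> {esym 1 B, esym 2 B, esym 3 B} \<Longrightarrow> 0 \<le> g w"
    and g: "g \<in> {esym 1 B, esym 2 B, esym 3 B}"
  note f = f[unfolded bip_poly_expand]
  have e: "0 \<le> esym 1 B w" "0 \<le> esym 2 B w" "0 \<le> esym 3 B w" using nn by blast+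
  have "esym 1 B w \<noteq> 0" using esym_vanish[of B w 4] esym_vanish[of B w 3] e(2) f by force
  then have p1: "0 < esym 1 B w" using e(1) by linarith
  have "esym 2 B w \<noteq> 0" using esym_2_eq_0[OF card_B p1] e(3) f by force
  then have p2: "0 < esym 2 B w" using e(2) by linarith
  have "esym 3 B w \<noteq> 0" using esym_3_eq_0[OF card_B p1 p2] f by force
  then show "0 < g w" using g p1 p2 e(3) by auto
next
  fix j w assume j: "j \<in> A" and "\<forall>g\<in>{esym 1 B, esym 2 B, esym 3 B}. 0 < g w"
  then have "esym 3 B w \<noteq> 0" by force
  from affine_nonpos[OF this, of "bip_poly 0 1 A B w"] show
    "\<exists>t. \<not> (0 < bip_poly 0 1 A B (w + axis j t) \<and> (\<forall>g\<in>{esym 1 B, esym 2 B, esym 3 B}. 0 < g (w + axis j t)))"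
    unfolding bip_poly_expand axis_A[OF j] by (auto simp: algebra_simps)
qed (use card_B in \<open>auto intro: esym_pos continuous_on_esym\<close>)

lemma garding_11: "garding (bip_poly 1 1 A B)"
proof (rule garding_bip_criterion[where G = "{esym 1 A, esym 1 B, esym 2 B, esym 3 B}"])
  fix w g assume f: "0 < bip_poly 1 1 A B w"
    and nn: "\<And>g. g \<in> {esym 1 A, esym 1 B, esym 2 B, esym 3 B} \<Longrightarrow> 0 \<le> g w"
    and g: "g \<in> {esym 1 A, esym 1 B, esym 2 B, esym 3 B}"
  note f = f[unfolded bip_poly_expand]
  have e: "0 \<le> esym 1 A w" "0 \<le> esym 1 B w" "0 \<le> esym 2 B w" "0 \<le> esym 3 B w" using nn by blast+
  have "esym 1 A w \<noteq> 0" "esym 3 B w \<noteq> 0" using f by force+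
  then have p: "0 < esym 1 A w" "0 < esym 3 B w" using e by linarith+
  have "esym 1 B w \<noteq> 0" using esym_vanish[of B w 3] e(3) p(2) by force
  then have p1: "0 < esym 1 B w" using e(2) by linarith
  have "esym 2 B w \<noteq> 0" using esym_2_eq_0[OF card_B p1] p(2) by force
  then show "0 < g w" using g p p1 e(3) by auto
next
  fix j w assume j: "j \<in> A"
  show "\<exists>t. \<not> (0 < bip_poly 1 1 A B (w + axis j t) \<and> (\<forall>g\<in>{esym 1 A, esym 1 B, esym 2 B, esym 3 B}. 0 < g (w + axis j t)))"
    using esym_1_line[OF j, of w] by auto
qed (use card_A card_B in \<open>auto intro: esym_pos continuous_on_esym\<close>)

lemma garding_12: "garding (bip_poly 1 2 A B)"
proof (rule garding_bip_criterion[where G = "{esym 1 A, esym 1 B, esym 2 B}"])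
  fix w g assume f: "0 < bip_poly 1 2 A B w"
    and nn: "\<And>g. g \<in> {esym 1 A, esym 1 B, esym 2 B} \<Longrightarrow> 0 \<le> g w"
    and g: "g \<in> {esym 1 A, esym 1 B, esym 2 B}"
  note f = f[unfolded bip_poly_expand]
  have e: "0 \<le> esym 1 A w" "0 \<le> esym 1 B w" "0 \<le> esym 2 B w" using nn by blast+
  have "esym 1 B w \<noteq> 0" using esym_vanish[of B w 2] esym_vanish[of B w 3] e(3) f by force
  then have p1: "0 < esym 1 B w" using e(2) by linarith
  have "esym 2 B w \<noteq> 0"
  proof
    assume z: "esym 2 B w = 0"
    then have "esym 1 A w * esym 3 B w \<le> 0"
      using esym_2_eq_0(1)[OF card_B p1 z] e(1) by (intro mult_nonneg_nonpos)
    then show False using f z by simp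
  qed
  then have p2: "0 < esym 2 B w" using e(3) by linarith
  have "esym 1 A w \<noteq> 0"
  proof
    assume z: "esym 1 A w = 0"
    then have "esym 2 A w * esym 2 B w \<le> 0"
      using esym_1_le_0(1)[OF z] e(3) by (intro mult_nonpos_nonneg)
    then show False using f z by simp
  qed
  then show "0 < g w" using g p1 p2 e(1) by auto
next
  fix j w assume j: "j \<in> A"
  show "\<exists>t. \<not> (0 < bip_poly 1 2 A B (w + axis j t) \<and> (\<forall>g\<in>{esym 1 A, esym 1 B, esym 2 B}. 0 < g (w + axis j t)))"
    using esym_1_line[OF j, of w] by auto
qed (use card_A card_B in \<open>auto intro: esym_pos continuous_on_esym\<close>)

lemma garding_22: "garding (bip_poly 2 2 A B)"
proof (rule garding_bip_criterion[where G = "{esym 1 A, esym 2 A, esym 1 B, esym 2 B}"])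
  fix w g assume f: "0 < bip_poly 2 2 A B w"
    and nn: "\<And>g. g \<in> {esym 1 A, esym 2 A, esym 1 B, esym 2 B} \<Longrightarrow> 0 \<le> g w"
    and g: "g \<in> {esym 1 A, esym 2 A, esym 1 B, esym 2 B}"
  note f = f[unfolded bip_poly_expand]
  have e: "0 \<le> esym 1 A w" "0 \<le> esym 2 A w" "0 \<le> esym 1 B w" "0 \<le> esym 2 B w" using nn by blast+
  have nz: "esym 2 A w \<noteq> 0" "esym 2 B w \<noteq> 0" using f by force+
  then have "esym 1 A w \<noteq> 0" "esym 1 B w \<noteq> 0"
    using esym_vanish[of A w 2] esym_vanish[of B w 2] e by force+
  then show "0 < g w" using g e nz by auto
next
  fix j w assume j: "j \<in> A"
  show "\<exists>t. \<not> (0 < bip_poly 2 2 A B (w + axis j t) \<and> (\<forall>g\<in>{esym 1 A, esym 2 A, esym 1 B, esym 2 B}. 0 < g (w + axis j t)))"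
    using esym_1_line[OF j, of w] by auto
qed (use card_A card_B in \<open>auto intro: esym_pos continuous_on_esym\<close>)

text \<open>
  Lines in the \<open>x\<close>-directions are excluded by \<open>D\<close>, on which \<open>x\<^sub>j\<close> acts with the positive slope
  \<open>(m-1) Y\<^sub>2\<close>.
\<close>
lemma garding_02:
  assumes mn: "real (card A) * real (card B) \<le> 5 * real (card A) + 3 * real (card B) - 9"
  shows "garding (bip_poly 0 2 A B)"
proof -
  define m where "m = real (card A)"
  have m: "4 \<le> m" using card_A by (simp add: m_def)
  define D where "D = (\<lambda>w. m * esym 3 B w + (m - 1) * (esym 1 A w * esym 2 B w))"
  show ?thesis
  proof (rule garding_bip_criterion[where G = "{esym 1 B, esym 2 B, D}"])
    fix g assume g: "g \<in> {esym 1 B, esym 2 B, D}"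
    have "continuous_on UNIV D" unfolding D_def by (intro continuous_intros)
    then show "continuous_on UNIV g" using g continuous_on_esym by blast
    fix w :: "real ^ 'e" assume w: "w \<in> pos_orthant"
    have "0 < D w" unfolding D_def
      using m card_A card_B by (intro add_pos_pos mult_pos_pos esym_pos w) auto
    then show "0 < g w" using g card_B w esym_pos[of w] by auto
  next
    fix w g assume f: "0 < bip_poly 0 2 A B w"
      and nn: "\<And>g. g \<in> {esym 1 B, esym 2 B, D} \<Longrightarrow> 0 \<le> g w"
      and g: "g \<in> {esym 1 B, esym 2 B, D}"
    note f = f[unfolded bip_poly_expand]
    have e: "0 \<le> esym 1 B w" "0 \<le> esym 2 B w" "0 \<le> D w" using nn by blast+
    have "esym 1 B w \<noteq> 0"
      using esym_vanish[of B w 2] esym_vanish[of B w 3] esym_vanish[of B w 4] e(2) f by force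
    then have p1: "0 < esym 1 B w" using e(1) by linarith
    have "esym 2 B w \<noteq> 0"
    proof
      assume z: "esym 2 B w = 0"
      have "0 \<le> esym 3 B w" using e(3) m z by (simp add: D_def zero_le_mult_iff)
      then show False using esym_2_eq_0[OF card_B p1 z] f z by force
    qed
    then have p2: "0 < esym 2 B w" using e(2) by linarith
    have "D w \<noteq> 0"
      using bip_02_boundary[OF refl card_A refl card_B mn p1 p2] f unfolding D_def m_def by force
    then show "0 < g w" using g p1 p2 e(3) by auto
  next
    fix j w assume j: "j \<in> A" and "\<forall>g\<in>{esym 1 B, esym 2 B, D}. 0 < g w"
    then have "0 < esym 2 B w" by blast
    then have "(m - 1) * esym 2 B w \<noteq> 0" using m by simp
    from affine_nonpos[OF this, of "D w"]
    have "\<exists>t. \<not> 0 < D (w + axis j t)"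
      unfolding D_def axis_A[OF j] by (simp add: algebra_simps)
    then show "\<exists>t. \<not> (0 < bip_poly 0 2 A B (w + axis j t) \<and> (\<forall>g\<in>{esym 1 B, esym 2 B, D}. 0 < g (w + axis j t)))"
      by auto
  qed auto
qed

text \<open>
  Here \<open>S\<close> excludes lines in the \<open>x\<close>-directions: it has slope \<open>(m-2) Y\<^sub>1 > 0\<close> in \<open>x\<^sub>j\<close>.
\<close>
lemma garding_03_13:
  assumes mn: "real (card A) * real (card B) \<le> 5 * real (card A) + 5 * real (card B) - 13"
    and l: "l \<in> {0, 1}"
  shows "garding (bip_poly l 3 A B)"
proof -
  define m where "m = real (card A)"
  have m: "4 \<le> m" using card_A by (simp add: m_def)
  define S where "S = (\<lambda>w. m * esym 2 B w + (m - 2) * (esym 1 A w * esym 1 B w))"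
  define D where "D = (\<lambda>w. m * esym 3 B w + (m - 1) * (esym 1 A w * esym 2 B w) +
    (m - 2) * (esym 2 A w * esym 1 B w))"
  show ?thesis
  proof (rule garding_bip_criterion[where G = "{esym 1 B, S, D}"])
    fix g assume g: "g \<in> {esym 1 B, S, D}"
    have "continuous_on UNIV D" "continuous_on UNIV S"
      unfolding D_def S_def by (intro continuous_intros)+
    then show "continuous_on UNIV g" using g continuous_on_esym by blast
    fix w :: "real ^ 'e" assume w: "w \<in> pos_orthant"
    have "0 < D w" "0 < S w" unfolding D_def S_def
      using m card_A card_B by (intro add_pos_pos mult_pos_pos esym_pos w; simp)+
    then show "0 < g w" using g card_B w esym_pos[of w] by auto
  next
    fix w g assume f: "0 < bip_poly l 3 A B w"
      and nn: "\<And>g. g \<in> {esym 1 B, S, D} \<Longrightarrow> 0 \<le> g w"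
      and g: "g \<in> {esym 1 B, S, D}"
    have e: "0 \<le> esym 1 B w" "0 \<le> S w" "0 \<le> D w" using nn by blast+
    from f l have f: "0 < bip_poly 0 3 A B w \<or> 0 < bip_poly 1 3 A B w" by blast
    have "esym 1 B w \<noteq> 0"
    proof
      assume z: "esym 1 B w = 0"
      have "0 \<le> esym 2 B w" using e(2) m z by (simp add: S_def zero_le_mult_iff)
      then have "esym k B w = 0" if "k > 0" for k using esym_vanish[OF z _ that] by blast
      then show False using f unfolding bip_poly_expand by simp
    qed
    then have p1: "0 < esym 1 B w" using e(1) by linarith
    have D0: "D w \<noteq> 0"
    proof
      assume "D w = 0"
      from bip_13_boundary[OF refl card_A refl card_B mn p1 e(2)[unfolded S_def m_def] this[unfolded D_def m_def]]
      show False using f unfolding bip_poly_expand by linarith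
    qed
    then have "0 < D w" using e(3) by linarith
    have "S w \<noteq> 0"
      using bip_13_side[OF refl card_A refl card_B mn p1] \<open>0 < D w\<close> unfolding S_def D_def m_def by force
    then show "0 < g w" using g p1 e \<open>0 < D w\<close> by auto
  next
    fix j w assume j: "j \<in> A" and "\<forall>g\<in>{esym 1 B, S, D}. 0 < g w"
    then have "0 < esym 1 B w" by blast
    then have "(m - 2) * esym 1 B w \<noteq> 0" using m by simp
    from affine_nonpos[OF this, of "S w"]
    have "\<exists>t. \<not> 0 < S (w + axis j t)"
      unfolding S_def axis_A[OF j] by (simp add: algebra_simps)
    then show "\<exists>t. \<not> (0 < bip_poly l 3 A B (w + axis j t) \<and> (\<forall>g\<in>{esym 1 B, S, D}. 0 < g (w + axis j t)))"
      by auto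
  qed (use l in auto)
qed

end

section \<open>Failure of the positive ray test\<close>

lemma esym_insert_numerals:
  assumes "a \<notin> A"
  shows "esym 1 (insert a A) w = esym 1 A w + w $ a"
    "esym 2 (insert a A) w = esym 2 A w + w $ a * esym 1 A w"
    "esym 3 (insert a A) w = esym 3 A w + w $ a * esym 2 A w"
  using esym_insert[OF assms, of 0 w] esym_insert[OF assms, of 1 w] esym_insert[OF assms, of 2 w]
  by (simp_all add: numeral_2_eq_2 numeral_3_eq_3)

lemma esym_const:
  fixes w :: "real ^ 'e::finite"
  assumes "\<And>e. e \<in> A \<Longrightarrow> w $ e = c"
  shows "esym k A w = real (card A choose k) * c ^ k"
proof -
  have "esym k A w = (\<Sum>S | S \<subseteq> A \<and> card S = k. c ^ k)"
    unfolding esym_def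
  proof (rule sum.cong)
    fix S assume "S \<in> {S. S \<subseteq> A \<and> card S = k}"
    then have S: "S \<subseteq> A" "card S = k" by auto
    have "(\<Prod>e\<in>S. w $ e) = (\<Prod>e\<in>S. c)" by (rule prod.cong) (use S assms in auto)
    then show "(\<Prod>e\<in>S. w $ e) = c ^ k" using S by simp
  qed simp
  then show ?thesis using n_subsets[of A k] by simp
qed

lemma quadratic_nonpos:
  fixes P Q R :: real
  assumes "P < 0"
  shows "\<exists>t\<ge>0. P * t\<^sup>2 + Q * t + R \<le> 0"
proof -
  define t where "t = (\<bar>Q\<bar> + \<bar>R\<bar>) / (- P) + 1"
  have t1: "1 \<le> t" using assms by (simp add: t_def divide_nonneg_neg)
  have "\<bar>Q\<bar> + \<bar>R\<bar> \<le> - P * t" using assms by (simp add: t_def field_simps)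
  then have "(\<bar>Q\<bar> + \<bar>R\<bar>) * t \<le> - P * t * t" using t1 by (intro mult_right_mono) auto
  moreover have "Q * t \<le> \<bar>Q\<bar> * t" using t1 by (intro mult_right_mono) auto
  moreover have "R \<le> \<bar>R\<bar> * t" using mult_left_mono[of 1 t "\<bar>R\<bar>"] t1 by linarith
  ultimately have "P * t\<^sup>2 + Q * t + R \<le> 0" by (simp add: power2_eq_square algebra_simps)
  then show ?thesis using t1 by (intro exI[of _ t]) auto
qed

lemma quadratic_pos:
  fixes a b c s :: real
  assumes "0 < a" "b\<^sup>2 < 4 * a * c"
  shows "0 < a * s\<^sup>2 + b * s + c"
proof -
  have "0 < (2 * a * s + b)\<^sup>2 + (4 * a * c - b\<^sup>2)" using assms by (intro add_nonneg_pos) auto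
  also have "\<dots> = 4 * a * (a * s\<^sup>2 + b * s + c)"
    by (simp add: power2_eq_square algebra_simps)
  finally show ?thesis using assms(1) by (simp add: zero_less_mult_iff)
qed

context bipartition
begin

text \<open>
  Two of the \<open>x\<close>-variables are kept apart, because a product of two increments is what drives the
  polynomial down in the cases \<open>(0,3)\<close> and \<open>(1,3)\<close>.
\<close>
definition test_point :: "'e \<Rightarrow> 'e \<Rightarrow> real \<Rightarrow> real \<Rightarrow> real \<Rightarrow> real ^ 'e" where
  "test_point j k \<alpha> \<beta> s = (\<chi> e. if e = j then \<alpha> else if e = k then \<beta> else if e \<in> A then s else 1)"

lemma esym_B_test_point:
  assumes "j \<in> A" "k \<in> A"
  shows "esym i B (test_point j k \<alpha> \<beta> s) = real (card B choose i)"
proof -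
  have "esym i B (test_point j k \<alpha> \<beta> s) = real (card B choose i) * 1 ^ i"
    by (rule esym_const) (use assms disjoint in \<open>auto simp: test_point_def\<close>)
  then show ?thesis by simp
qed

lemma esym_A_test_point:
  fixes \<alpha> \<beta> s :: real
  assumes jk: "j \<in> A" "k \<in> A" "j \<noteq> k"
  defines "c \<equiv> \<lambda>i. real (card A - 2 choose i) * s ^ i"
  shows "esym 1 A (test_point j k \<alpha> \<beta> s) = c 1 + (\<alpha> + \<beta>)"
    "esym 2 A (test_point j k \<alpha> \<beta> s) = c 2 + (\<alpha> + \<beta>) * c 1 + \<alpha> * \<beta>"
    "esym 3 A (test_point j k \<alpha> \<beta> s) = c 3 + (\<alpha> + \<beta>) * c 2 + \<alpha> * \<beta> * c 1"
proof -
  define A' where "A' = A - {j, k}"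
  define w where "w = test_point j k \<alpha> \<beta> s"
  have A: "A = insert j (insert k A')" "j \<notin> insert k A'" "k \<notin> A'" using jk by (auto simp: A'_def)
  have "card A' = card A - 2" using jk by (simp add: A'_def card_Diff_subset)
  then have c: "esym i A' w = c i" for i
    unfolding c_def by (subst esym_const[of A' w s]) (auto simp: A'_def w_def test_point_def)
  have w: "w $ j = \<alpha>" "w $ k = \<beta>" using jk by (simp_all add: w_def test_point_def)
  show "esym 1 A (test_point j k \<alpha> \<beta> s) = c 1 + (\<alpha> + \<beta>)"
    "esym 2 A (test_point j k \<alpha> \<beta> s) = c 2 + (\<alpha> + \<beta>) * c 1 + \<alpha> * \<beta>"
    "esym 3 A (test_point j k \<alpha> \<beta> s) = c 3 + (\<alpha> + \<beta>) * c 2 + \<alpha> * \<beta> * c 1"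
    unfolding w_def[symmetric]
    by (subst A(1), unfold esym_insert_numerals[OF A(2)] esym_insert_numerals[OF A(3)] c w,
        simp add: algebra_simps)+
qed

lemma test_point_add:
  assumes "j \<noteq> k"
  shows "test_point j k \<alpha> \<beta> s + (axis j t + axis k t') = test_point j k (\<alpha> + t) (\<beta> + t') s"
  using assms by (auto simp: vec_eq_iff test_point_def axis_def)

lemma continuous_on_test_point:
  assumes "continuous_on S \<alpha>"
  shows "continuous_on S (\<lambda>s. test_point j k (\<alpha> s) s s)"
  unfolding test_point_def
proof (rule continuous_on_vec_lambda)
  fix e
  show "continuous_on S (\<lambda>s. if e = j then \<alpha> s else if e = k then s else if e \<in> A then s else 1)"
    using assms by (cases "e = j"; cases "e = k"; cases "e \<in> A") (auto intro!: continuous_intros)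
qed

text \<open>
  At \<open>s = 1\<close> the path is in the orthant; from its point at \<open>s\<^sub>0\<close> the nonnegative increments \<open>t, t'\<close> of
  \<open>x\<^sub>j\<close> and \<open>x\<^sub>k\<close> lead out of \<open>{f > 0}\<close>.
\<close>
lemma not_garding_by_path:
  assumes lu: "l \<le> u" "u \<le> 4" and jk: "j \<in> A" "k \<in> A" "j \<noteq> k"
    and \<alpha>: "continuous_on UNIV \<alpha>" "0 < \<alpha> 1"
    and path: "\<And>s. 0 < bip_poly l u A B (test_point j k (\<alpha> s) s s)"
    and t: "0 \<le> t" "0 \<le> t'" "bip_poly l u A B (test_point j k (\<alpha> s0 + t) (s0 + t') s0) \<le> 0"
  shows "\<not> garding (bip_poly l u A B)"
proof (rule not_garding_criterion)
  let ?T = "range (\<lambda>s. test_point j k (\<alpha> s) s s)"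
  show "0 < bip_poly l u A B w" if "w \<in> pos_orthant" for w by (rule bip_poly_pos[OF lu that])
  show "connected ?T" by (intro connected_continuous_image continuous_on_test_point \<alpha>) auto
  show "?T \<subseteq> {w. 0 < bip_poly l u A B w}" using path by auto
  show "test_point j k (\<alpha> 1) 1 1 \<in> ?T" "test_point j k (\<alpha> s0) s0 s0 \<in> ?T" by auto
  show "test_point j k (\<alpha> 1) 1 1 \<in> pos_orthant"
    using \<alpha>(2) by (auto simp: pos_orthant_def test_point_def)
  show "0 \<le> (axis j t + axis k t') $ i" for i using t by (simp add: axis_def)
  show "bip_poly l u A B (test_point j k (\<alpha> s0) s0 s0 + (axis j t + axis k t')) \<le> 0"
    unfolding test_point_add[OF jk(3)] by (rule t(3))
qed

lemma two_elements_A: obtains j k where "j \<in> A" "k \<in> A" "j \<noteq> k"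
proof -
  have two: "2 \<le> card A" using card_A by simp
  obtain S where "S \<subseteq> A" "card S = 2"
    using obtain_subset_with_card_n[OF two] by blast
  then show ?thesis using that by (auto simp: card_2_iff)
qed

text \<open>
  On the diagonal \<open>x = (s,\<dots>,s)\<close>, \<open>y = (1,\<dots>,1)\<close> the polynomial is a quadratic in \<open>s\<close> whose discriminant
  is negative exactly when the bound on \<open>mn\<close> fails.  At \<open>s = -n\<close> the slope \<open>d\<close> in direction \<open>x\<^sub>k\<close> is
  negative.
\<close>
lemma not_garding_02:
  assumes mn: "5 * real (card A) + 3 * real (card B) - 9 < real (card A) * real (card B)"
  shows "\<not> garding (bip_poly 0 2 A B)"
proof -
  define m n where "m = real (card A)" "n = real (card B)"
  have mn4: "4 \<le> m" "4 \<le> n" using card_A card_B by (simp_all add: m_n_def)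
  have m2: "real (card A - 2) = m - 2" using card_A by (simp add: m_n_def of_nat_diff)
  obtain j k where jk: "j \<in> A" "k \<in> A" "j \<noteq> k" by (rule two_elements_A)
  have F: "bip_poly 0 2 A B (test_point j k s \<beta> s) = n * (n - 1) / 24 *
      ((12 * (m - 1) * s + 4 * (n - 2)) * \<beta> + (6 * (m - 1) * (m - 2) * s\<^sup>2 + 4 * (m - 1) * (n - 2) * s + (n - 2) * (n - 3)))"
    for s \<beta>
    unfolding bip_poly_expand esym_A_test_point[OF jk] esym_B_test_point[OF jk(1,2)] real_choose_small m2
    unfolding m_n_def[symmetric] by (simp add: m2 power2_eq_square field_simps)
  have pos: "0 < bip_poly 0 2 A B (test_point j k s s s)" for s
  proof -
    have "0 < (2 * m * (n - 2)) * (4 * (3 * (m - 1) * (n - 3) - 2 * m * (n - 2)))"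
      using mn mn4 unfolding m_n_def[symmetric]
      by (intro mult_pos_pos) (simp_all add: algebra_simps)
    then have "(4 * m * (n - 2))\<^sup>2 < 4 * (6 * m * (m - 1)) * ((n - 2) * (n - 3))"
      by (simp add: power2_eq_square algebra_simps)
    then have "0 < 6 * m * (m - 1) * s\<^sup>2 + 4 * m * (n - 2) * s + (n - 2) * (n - 3)"
      using mn4 by (intro quadratic_pos) auto
    then have "0 < n * (n - 1) / 24 * (6 * m * (m - 1) * s\<^sup>2 + 4 * m * (n - 2) * s + (n - 2) * (n - 3))"
      using mn4 by (intro mult_pos_pos) auto
    moreover have "bip_poly 0 2 A B (test_point j k s s s) = n * (n - 1) / 24 *
        (6 * m * (m - 1) * s\<^sup>2 + 4 * m * (n - 2) * s + (n - 2) * (n - 3))"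
      unfolding F by (simp add: power2_eq_square algebra_simps)
    ultimately show ?thesis by (simp only:)
  qed
  define d where "d = n * (n - 1) / 24 * (12 * (m - 1) * (- n) + 4 * (n - 2))"
  have d: "d < 0"
  proof -
    have "4 * n \<le> m * n" using mn4 by (intro mult_right_mono) auto
    moreover have "12 * (m - 1) * (- n) + 4 * (n - 2) = 16 * n - 8 - 12 * (m * n)"
      by (simp add: algebra_simps)
    ultimately have "12 * (m - 1) * (- n) + 4 * (n - 2) < 0" using mn4 by linarith
    then show ?thesis unfolding d_def using mn4 by (intro mult_pos_neg) auto
  qed
  define c where "c = bip_poly 0 2 A B (test_point j k (- n) (- n) (- n))"
  define t where "t = - c / d"
  have "0 \<le> t" using pos[of "- n"] d by (simp add: t_def c_def divide_nonneg_neg zero_le_divide_iff)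
  moreover have "bip_poly 0 2 A B (test_point j k (- n) (- n + t) (- n)) = c + t * d"
    unfolding c_def F d_def by (simp add: field_simps)
  then have "bip_poly 0 2 A B (test_point j k (- n + 0) (- n + t) (- n)) \<le> 0"
    using d by (simp add: t_def)
  ultimately show ?thesis
    using not_garding_by_path[OF _ _ jk, of 0 2 "\<lambda>s. s" 0 t "- n"] pos by simp
qed

text \<open>
  With \<open>x\<^sub>j = \<alpha>\<close>, the other \<open>x\<^sub>i\<close> equal to \<open>s\<close> and \<open>y = (1,\<dots>,1)\<close> the polynomial is \<open>\<alpha> h(s) + g(s)\<close>, and
  \<open>h\<close> is a quadratic whose discriminant is negative exactly when the bound on \<open>mn\<close> fails.  So
  \<open>h > 0\<close>, and a large \<open>\<alpha>\<close> keeps the polynomial positive for all \<open>s\<close>.  At \<open>s = -n\<close> the mixed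
  derivative with respect to \<open>x\<^sub>j\<close> and \<open>x\<^sub>k\<close> is negative, so raising both variables leads to
  nonpositive values.
\<close>
lemma not_garding_03_13:
  assumes mn: "5 * real (card A) + 5 * real (card B) - 13 < real (card A) * real (card B)"
    and l: "l \<in> {0, 1}"
  shows "\<not> garding (bip_poly l 3 A B)"
proof -
  define m n where "m = real (card A)" "n = real (card B)"
  have mn4: "4 \<le> m" "4 \<le> n" using card_A card_B by (simp_all add: m_n_def)
  have m2: "real (card A - 2) = m - 2" using card_A by (simp add: m_n_def of_nat_diff)
  obtain j k where jk: "j \<in> A" "k \<in> A" "j \<noteq> k" by (rule two_elements_A)
  \<comment> \<open>\<open>\<epsilon>\<close> switches the term \<open>Y\<^sub>4\<close> on and off, which is the difference between the two cases\<close>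
  define \<epsilon> :: real where "\<epsilon> = (if l = 0 then 1 else 0)"
  define c1 c2 c3 where "c1 = (\<lambda>s. (m - 2) * s)" "c2 = (\<lambda>s. (m - 2) * (m - 3) / 2 * s\<^sup>2)"
    "c3 = (\<lambda>s. (m - 2) * (m - 3) * (m - 4) / 6 * s ^ 3)"
  define y2 y3 y4 where "y2 = n * (n - 1) / 2" "y3 = n * (n - 1) * (n - 2) / 6"
    "y4 = n * (n - 1) * (n - 2) * (n - 3) / 24"
  have F: "bip_poly l 3 A B (test_point j k \<alpha> \<beta> s) = \<epsilon> * y4 + ((c1 s + (\<alpha> + \<beta>)) * y3 +
      (c2 s + (\<alpha> + \<beta>) * c1 s + \<alpha> * \<beta>) * y2 + (c3 s + (\<alpha> + \<beta>) * c2 s + \<alpha> * \<beta> * c1 s) * n)" for \<alpha> \<beta> s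
  proof -
    have *: "bip_poly l 3 A B w = \<epsilon> * esym 4 B w +
      (esym 1 A w * esym 3 B w + esym 2 A w * esym 2 B w + esym 3 A w * esym 1 B w)" for w
      using l bip_poly_expand(4,7)[of A B w] by (auto simp: \<epsilon>_def simp del: One_nat_def)
    show ?thesis
      unfolding * esym_A_test_point[OF jk] esym_B_test_point[OF jk(1,2)] real_choose_small choose_one m2
        c1_c2_c3_def y2_y3_y4_def
      unfolding m_n_def[symmetric] by (simp add: m2)
  qed
  define h where "h = (\<lambda>s. y3 + (c1 s + s) * y2 + (c2 s + s * c1 s) * n)"
  have h: "0 < h s" for s
  proof -
    have "0 < (3 * (m - 1) * (n - 1)) * (4 * (m - 2) * (n - 2) - 3 * (m - 1) * (n - 1))"
      using mn mn4 unfolding m_n_def[symmetric]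
      by (intro mult_pos_pos) (simp_all add: algebra_simps)
    then have "(3 * (m - 1) * (n - 1))\<^sup>2 < 4 * (3 * (m - 1) * (m - 2)) * ((n - 1) * (n - 2))"
      by (simp add: power2_eq_square algebra_simps)
    then have "0 < 3 * (m - 1) * (m - 2) * s\<^sup>2 + 3 * (m - 1) * (n - 1) * s + (n - 1) * (n - 2)"
      using mn4 by (intro quadratic_pos) auto
    then have "0 < n / 6 * (3 * (m - 1) * (m - 2) * s\<^sup>2 + 3 * (m - 1) * (n - 1) * s + (n - 1) * (n - 2))"
      using mn4 by (intro mult_pos_pos) auto
    also have "\<dots> = h s"
      unfolding h_def c1_c2_c3_def y2_y3_y4_def by (simp add: power2_eq_square field_simps)
    finally show ?thesis .
  qed
  define g where "g = (\<lambda>s. \<epsilon> * y4 + ((c1 s + s) * y3 + (c2 s + s * c1 s) * y2 + (c3 s + s * c2 s) * n))"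
  define \<alpha> where "\<alpha> = (\<lambda>s. 1 + \<bar>g s\<bar> / h s)"
  have \<alpha>1: "1 \<le> \<alpha> s" for s using h[of s] by (simp add: \<alpha>_def)
  have cont: "continuous_on UNIV \<alpha>"
  proof -
    have "continuous_on UNIV g" "continuous_on UNIV h"
      unfolding g_def h_def c1_c2_c3_def by (intro continuous_intros)+
    then show ?thesis unfolding \<alpha>_def
      using h by (intro continuous_intros) (auto simp: less_imp_neq[symmetric])
  qed
  have pos: "0 < bip_poly l 3 A B (test_point j k (\<alpha> s) s s)" for s
  proof -
    have "bip_poly l 3 A B (test_point j k (\<alpha> s) s s) = \<alpha> s * h s + g s"
      unfolding F h_def g_def by (simp add: algebra_simps)
    also have "\<alpha> s * h s = h s + \<bar>g s\<bar>" using h[of s] by (simp add: \<alpha>_def field_simps)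
    finally show ?thesis using h[of s] by linarith
  qed
  have P: "y2 + c1 (- n) * n < 0"
  proof -
    have "4 * n \<le> m * n" using mn4 by (intro mult_right_mono) auto
    moreover have "(n - 1) / 2 - (m - 2) * n = 5 / 2 * n - 1 / 2 - m * n"
      by (simp add: field_simps)
    ultimately have "(n - 1) / 2 - (m - 2) * n < 0" using mn4 by linarith
    then have "n * ((n - 1) / 2 - (m - 2) * n) < 0" using mn4 by (intro mult_pos_neg) auto
    then show ?thesis by (simp add: y2_y3_y4_def c1_c2_c3_def algebra_simps)
  qed
  define \<alpha>0 where "\<alpha>0 = \<alpha> (- n)"
  define Q where "Q = 2 * y3 + (2 * c1 (- n) + (\<alpha>0 - n)) * y2 + (2 * c2 (- n) + (\<alpha>0 - n) * c1 (- n)) * n"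
  define R where "R = bip_poly l 3 A B (test_point j k \<alpha>0 (- n) (- n))"
  obtain t where t: "0 \<le> t" "(y2 + c1 (- n) * n) * t\<^sup>2 + Q * t + R \<le> 0"
    using quadratic_nonpos[OF P] by blast
  have "bip_poly l 3 A B (test_point j k (\<alpha>0 + t) (- n + t) (- n)) = (y2 + c1 (- n) * n) * t\<^sup>2 + Q * t + R"
    unfolding R_def Q_def F by (simp add: power2_eq_square algebra_simps)
  then have fin: "bip_poly l 3 A B (test_point j k (\<alpha> (- n) + t) (- n + t) (- n)) \<le> 0"
    using t(2) by (simp add: \<alpha>0_def)
  show ?thesis
    by (rule not_garding_by_path[OF _ _ jk cont _ pos t(1) t(1) fin]) (use l \<alpha>1[of 1] in auto)
qed

lemma garding_02_iff:
  "garding (bip_poly 0 2 A B) \<longleftrightarrow> int (card A) * int (card B) \<le> 5 * int (card A) + 3 * int (card B) - 9"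
proof -
  have "int (card A) * int (card B) \<le> 5 * int (card A) + 3 * int (card B) - 9 \<longleftrightarrow>
     real (card A) * real (card B) \<le> 5 * real (card A) + 3 * real (card B) - 9"
    by (subst of_int_le_iff[where 'a = real, symmetric])
      (simp only: of_int_mult of_int_add of_int_diff of_int_numeral of_int_of_nat_eq)
  then show ?thesis using garding_02 not_garding_02 by (meson not_le)
qed

lemma garding_03_13_iff:
  assumes "l \<in> {0, 1}"
  shows "garding (bip_poly l 3 A B) \<longleftrightarrow>
    int (card A) * int (card B) \<le> 5 * int (card A) + 5 * int (card B) - 13"
proof -
  have "int (card A) * int (card B) \<le> 5 * int (card A) + 5 * int (card B) - 13 \<longleftrightarrow>
     real (card A) * real (card B) \<le> 5 * real (card A) + 5 * real (card B) - 13"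
    by (subst of_int_le_iff[where 'a = real, symmetric])
      (simp only: of_int_mult of_int_add of_int_diff of_int_numeral of_int_of_nat_eq)
  then show ?thesis using garding_03_13 not_garding_03_13 assms by (meson not_le)
qed

end

section \<open>The classification\<close>

theorem theorem14p8:
  fixes A B :: "'e::finite set" and m n l u :: nat
  assumes "A \<inter> B = {}" and "A \<union> B = UNIV"
    and "card A = m" and "card B = n"
    and "m \<ge> 4" and "n \<ge> 4"
    and "l \<le> u" and "u \<le> 4"
  defines "f \<equiv> bip_poly l u A B"
    and "\<B> \<equiv> {T. card T = 4 \<and> l \<le> card (T \<inter> A) \<and> card (T \<inter> A) \<le> u}"
  shows "matroid_bases \<B> \<and> (\<forall>T\<in>\<B>. card T = 4) \<and> (garding f \<longleftrightarrow> B_garding \<B>) \<and>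
    ((l, u) \<in> {(0,0), (0,1), (0,4), (1,1), (1,2), (2,2), (2,3), (3,3), (3,4), (4,4)} \<longrightarrow>
       garding f) \<and>
    ((l, u) = (0, 2) \<longrightarrow>
       (garding f \<longleftrightarrow> int m * int n \<le> 5 * int m + 3 * int n - 9)) \<and>
    ((l, u) = (2, 4) \<longrightarrow>
       (garding f \<longleftrightarrow> int m * int n \<le> 3 * int m + 5 * int n - 9)) \<and>
    ((l, u) \<in> {(0,3), (1,3), (1,4)} \<longrightarrow>
       (garding f \<longleftrightarrow> int m * int n \<le> 5 * int m + 5 * int n - 13))"
proof -
  interpret bipartition A B using assms by unfold_locales auto
  interpret swapped: bipartition B A using assms by unfold_locales auto
  have \<B>: "\<B> = bip_bases l u A" by (simp add: \<B>_def bip_bases_def)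
  have swap: "bip_poly a b A B = bip_poly (4 - b) (4 - a) B A" if "a \<le> b" "b \<le> 4" for a b
    by (intro ext bip_poly_swap that)
  have matroid: "matroid_bases \<B>"
    unfolding \<B> using assms by (intro matroid_bases_bip[of A B]) auto
  have rank: "\<forall>T\<in>\<B>. card T = 4" by (simp add: \<B>_def)
  have gen: "garding f \<longleftrightarrow> B_garding \<B>"
    unfolding B_garding_def \<B> f_def bip_poly_eq_basis_genfun[OF assms(1,2,8)] ..
  have always: "garding f" if "(l, u) \<in> {(0,0), (0,1), (0,4), (1,1), (1,2), (2,2), (2,3), (3,3), (3,4), (4,4)}"
    using that swap[of 2 3] swap[of 3 3] swap[of 3 4] swap[of 4 4]
      garding_00 garding_01 garding_04 garding_11 garding_12 garding_22
      swapped.garding_00 swapped.garding_01 swapped.garding_11 swapped.garding_12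
    unfolding f_def by (elim insertE emptyE Pair_inject; simp)
  have c02: "garding f \<longleftrightarrow> int m * int n \<le> 5 * int m + 3 * int n - 9" if "(l, u) = (0, 2)"
    using that garding_02_iff unfolding f_def assms(3,4)[symmetric] by simp
  have c24: "garding f \<longleftrightarrow> int m * int n \<le> 3 * int m + 5 * int n - 9" if "(l, u) = (2, 4)"
    using that swapped.garding_02_iff swap[of 2 4] unfolding f_def assms(3,4)[symmetric]
    by (simp add: mult.commute add.commute)
  have c13: "garding f \<longleftrightarrow> int m * int n \<le> 5 * int m + 5 * int n - 13" if "(l, u) \<in> {(0,3), (1,3), (1,4)}"
    using that garding_03_13_iff[of 0] garding_03_13_iff[of 1] swapped.garding_03_13_iff[of 0] swap[of 1 4]
    unfolding f_def assms(3,4)[symmetric]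
    by (elim insertE emptyE Pair_inject) (simp_all add: mult.commute add.commute)
  show ?thesis using matroid rank gen always c02 c24 c13 by blast
qed

end
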